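(* Let $X$ be a right-continuous strong Markov process valued in a Polish space $\mathcal X$, let $\phi:\mathbb R\to\mathbb R$ be concave, differentiable and Lipschitz, and let $\mathbf P_t$, $\mathbf R_t$, $\mathbf V_t$ be the operators defined in the context. Then for all bounded measurable $f:\mathcal X\to\mathbb R$ and all integers $n\ge1$ we have $$(\mathbf P_{t/n}\circ\mathbf R_{t/n})^n(f)(x)\ \le\ \mathbf V_t(f)(x)\ \le\ (\mathbf R_{t/n}\circ\mathbf P_{t/n})^n(f)(x)$$ for all $(t,x)\in\mathbb R_+\times\mathcal X$.
   Context: $\mathbb E_x$ denotes expectation when $X_0=x$. $\mathbf V_t$ is the operator sending a bounded measurable function $v_0:\mathcal X\to\mathbb R$ to $v(t,\cdot)$, where $v:\mathbb R_+\times\mathcal X\to\mathbb R$ is the unique solution, bounded on $[0,t]\times\mathcal X$ for every finite $t$, of the integral equation $$v(t,x)=\mathbb E_x\Big[v_0(X_t)+\int_0^t\phi(v(t-s,X_s))\,ds\Big]\quad\text{for all }(t,x)\in\mathbb R_+\times\mathcal X .$$ $\mathbf P_t$ is the transition operator of the Markov process: $\mathbf P_t(f)(x)=\mathbb E_x[f(X_t)]$ for bounded measurable $f$. For $r_0\in\mathbb R$, $R_t(r_0)=r(t)$ where $r:\mathbb R_+\to\mathbb R$ solves the ordinary differential equation $\dot r=\phi(r)$, $r(0)=r_0$ (equivalently, $R_t(r_0)$ is the constant value of $\mathbf V_t$ applied to the constant function $r_0$). $\mathbf R_t$ is the operator $\mathbf R_t(f)(x)=R_t(f(x))$. *)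

theory Defs
  imports "HOL-Probability.Probability"
begin

text \<open>
  The process is the usual family of laws \<^term>\<open>P x\<close> (one for each starting point) on one
  measurable space \<^term>\<open>M\<close>, so that expectation with respect to \<^term>\<open>P x\<close> is the operator
  written $E_x$. Times are real and only times \<open>\<ge> 0\<close> matter. The filtration is indexed by
  \<^typ>\<open>ennreal\<close> because stopping times may take the value \<open>\<infinity>\<close>; it is arbitrary, so the natural
  filtration and its right-continuous version are both covered.

  The strong Markov property is
  $E_x[1_{\tau<\infty} g(X_{\tau+t}) | F_\tau] = 1_{\tau<\infty} E_{X_\tau}[g(X_t)]$
  almost surely under \<^term>\<open>P x\<close>. The value of \<^term>\<open>enn2real\<close> at \<open>\<infinity>\<close> is irrelevant,
  because of the indicator.
\<close>

locale strong_markov_process = filtration "space M" F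
  for M :: "'w measure" and F :: "ennreal \<Rightarrow> 'w measure" +
  fixes P :: "'a::polish_space \<Rightarrow> 'w measure" and X :: "real \<Rightarrow> 'w \<Rightarrow> 'a"
  assumes F_subalgebra: "\<And>t. subalgebra M (F t)"
    and prob_space_P: "\<And>x. prob_space (P x)"
    and sets_P: "\<And>x. sets (P x) = sets M"
    and adapted: "\<And>t. t \<ge> 0 \<Longrightarrow> X t \<in> F (ennreal t) \<rightarrow>\<^sub>M borel"
    and start: "\<And>x. AE \<omega> in P x. X 0 \<omega> = x"
    and transition_measurable:
      "\<And>t B. t \<ge> 0 \<Longrightarrow> B \<in> sets borel \<Longrightarrow>
        (\<lambda>x. measure (P x) {\<omega> \<in> space M. X t \<omega> \<in> B}) \<in> borel_measurable borel"
    and strong_markov: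
      "\<And>x \<tau> t g. stopping_time F \<tau> \<Longrightarrow> t \<ge> 0 \<Longrightarrow>
        (g :: 'a \<Rightarrow> real) \<in> borel_measurable borel \<Longrightarrow> bounded (range g) \<Longrightarrow>
        AE \<omega> in P x.
          real_cond_exp (P x) (pre_sigma \<tau>)
            (\<lambda>\<omega>. indicator {\<omega>. \<tau> \<omega> < \<infinity>} \<omega> * g (X (enn2real (\<tau> \<omega>) + t) \<omega>)) \<omega>
          = indicator {\<omega>. \<tau> \<omega> < \<infinity>} \<omega> * (\<integral>\<omega>'. g (X t \<omega>') \<partial>P (X (enn2real (\<tau> \<omega>)) \<omega>))"

locale right_continuous_strong_markov_process = strong_markov_process +
  assumes right_continuous:
    "\<And>\<omega> t. \<omega> \<in> space M \<Longrightarrow> t \<ge> 0 \<Longrightarrow> continuous (at_right t) (\<lambda>s. X s \<omega>)"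

definition transition_op ::
  "('a \<Rightarrow> 'w measure) \<Rightarrow> (real \<Rightarrow> 'w \<Rightarrow> 'a) \<Rightarrow> real \<Rightarrow> ('a \<Rightarrow> real) \<Rightarrow> 'a \<Rightarrow> real" where
  "transition_op P X t f x = (\<integral>\<omega>. f (X t \<omega>) \<partial>P x)"

definition ode_solution :: "(real \<Rightarrow> real) \<Rightarrow> real \<Rightarrow> (real \<Rightarrow> real) \<Rightarrow> bool" where
  "ode_solution \<phi> r0 r \<longleftrightarrow>
    r 0 = r0 \<and> (\<forall>t\<ge>0. (r has_real_derivative \<phi> (r t)) (at t within {0..}))"

text \<open>
  A solution is determined only at times \<open>\<ge> 0\<close>, hence the description of its value at \<^term>\<open>t\<close>
  rather than of the solution itself; likewise in the definition of \<open>evolution_op\<close> below.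
\<close>

definition ode_flow :: "(real \<Rightarrow> real) \<Rightarrow> real \<Rightarrow> real \<Rightarrow> real" where
  "ode_flow \<phi> t r0 = (THE y. \<exists>r. ode_solution \<phi> r0 r \<and> y = r t)"

definition reaction_op :: "(real \<Rightarrow> real) \<Rightarrow> real \<Rightarrow> ('a \<Rightarrow> real) \<Rightarrow> 'a \<Rightarrow> real" where
  "reaction_op \<phi> t f x = ode_flow \<phi> t (f x)"

text \<open>
  Joint measurability of \<^term>\<open>v\<close> is required explicitly: without it the integrals below, which are
  total in HOL with value 0 on non-integrable functions, could be meaningless.
\<close>

definition evolution_solution ::
  "('a::topological_space \<Rightarrow> 'w measure) \<Rightarrow> (real \<Rightarrow> 'w \<Rightarrow> 'a) \<Rightarrow> (real \<Rightarrow> real) \<Rightarrow>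
    ('a \<Rightarrow> real) \<Rightarrow> (real \<Rightarrow> 'a \<Rightarrow> real) \<Rightarrow> bool" where
  "evolution_solution P X \<phi> v0 v \<longleftrightarrow>
    (\<lambda>(t, x). v t x) \<in> borel_measurable (restrict_space borel {0..} \<Otimes>\<^sub>M borel) \<and>
    (\<forall>t\<ge>0. bounded ((\<lambda>(s, x). v s x) ` ({0..t} \<times> UNIV))) \<and>
    (\<forall>t\<ge>0. \<forall>x. v t x =
      (\<integral>\<omega>. v0 (X t \<omega>) + (LINT s:{0..t}|lborel. \<phi> (v (t - s) (X s \<omega>))) \<partial>P x))"

definition evolution_op ::
  "('a::topological_space \<Rightarrow> 'w measure) \<Rightarrow> (real \<Rightarrow> 'w \<Rightarrow> 'a) \<Rightarrow> (real \<Rightarrow> real) \<Rightarrow>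
    real \<Rightarrow> ('a \<Rightarrow> real) \<Rightarrow> 'a \<Rightarrow> real" where
  "evolution_op P X \<phi> t v0 = (THE g. \<exists>v. evolution_solution P X \<phi> v0 v \<and> g = v t)"

end

theory Submission
  imports Defs
begin

text \<open>
  Write \<open>P\<^sub>t\<close>, \<open>R\<^sub>t\<close>, \<open>V\<^sub>t\<close> for the transition, reaction and evolution operators. It suffices to treat a
  single step, \<open>P\<^sub>t R\<^sub>t f \<le> V\<^sub>t f \<le> R\<^sub>t P\<^sub>t f\<close>: as \<open>V\<close> is a semigroup and \<open>P\<close> and \<open>R\<close> preserve order, the
  \<open>n\<close>-step inequalities follow by induction (\<open>splitting_bounds\<close>).

  A single step is a comparison of sub- and supersolutions. By Fubini the defining equation of
  \<open>v(t) = V\<^sub>t f\<close> is Duhamel's formula \<open>v(t) = P\<^sub>t f + \<integral>\<^sub>0\<^sup>t P\<^sub>s \<phi>(v(t - s)) ds\<close>. If \<open>L\<close> is a Lipschitz constant of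
  \<open>\<phi>\<close>, the reaction \<open>\<psi>(r) = \<phi>(r) + L r\<close> is nondecreasing, and the formula is equivalent to
  \<open>v(t) = e\<^sup>-\<^sup>L\<^sup>t P\<^sub>t f + \<integral>\<^sub>0\<^sup>t e\<^sup>-\<^sup>L\<^sup>s P\<^sub>s \<psi>(v(t - s)) ds\<close> (\<open>mild_solution_absorb_decay\<close>). The right-hand side is now
  monotone in \<open>v\<close>, which yields a comparison principle (\<open>duhamel_comparison\<close>).

  The functions \<open>\<psi>\<close> and \<open>R\<^sub>t\<close> are concave, the latter because a convex combination of two orbits of the
  reaction is a subsolution (\<open>concave_ode_flow\<close>). In the formula above, with \<open>R\<close> in place of \<open>v\<close> and without the
  \<open>P\<^sub>s\<close>, Jensen's inequality therefore shows that \<open>R\<^sub>t P\<^sub>t f\<close> is a supersolution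
  (\<open>mild_solution_le_reaction_after_diffusion\<close>) and that \<open>P\<^sub>t R\<^sub>t f\<close> is a subsolution
  (\<open>diffusion_after_reaction_le_mild_solution\<close>).

  The operators \<open>V\<close> and \<open>R\<close> are given by definite descriptions, so solutions must be shown to exist and to be
  unique. Picard iteration and the comparison principle do this for all Markov kernels at once;
  the flow \<open>R\<close> is the case of a process that does not move. The strong Markov property enters only through the
  semigroup law, and right-continuity of paths only through measurability in time.
\<close>

section \<open>Integrals over bounded time intervals\<close>

lemma set_integrable_bounded_Icc:
  fixes g :: "real \<Rightarrow> real"
  assumes [measurable]: "g \<in> borel_measurable borel" and bnd: "\<And>s. s \<in> {a..b} \<Longrightarrow> \<bar>g s\<bar> \<le> B"
  shows "set_integrable lborel {a..b} g"
proof (rule set_integrable_bound[where f = "\<lambda>_. B"])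
  show "set_integrable lborel {a..b} (\<lambda>_. B)"
    by (intro borel_integrable_atLeastAtMost') simp
  show "set_borel_measurable lborel {a..b} g"
    by (simp add: set_borel_measurable_def)
qed (use bnd in force)

lemma LINT_Icc_abs_le:
  fixes g :: "real \<Rightarrow> real"
  assumes "a \<le> b" "g \<in> borel_measurable borel" "\<And>s. s \<in> {a..b} \<Longrightarrow> \<bar>g s\<bar> \<le> B"
  shows "\<bar>LINT s:{a..b}|lborel. g s\<bar> \<le> (b - a) * B"
proof -
  note int = set_integrable_bounded_Icc[OF assms(2,3)]
  have c: "set_integrable lborel {a..b} (\<lambda>_. k)" for k :: real
    by (intro borel_integrable_atLeastAtMost') simp
  have "(LINT s:{a..b}|lborel. g s) \<le> (LINT s:{a..b}|lborel. B)"
    using assms(3) by (intro set_integral_mono int c) (auto simp: abs_le_iff)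
  moreover have "(LINT s:{a..b}|lborel. -B) \<le> (LINT s:{a..b}|lborel. g s)"
  proof (intro set_integral_mono int c)
    show "- B \<le> g s" if "s \<in> {a..b}" for s
      using assms(3)[OF that] by linarith
  qed
  ultimately show ?thesis
    using assms(1) by (simp add: set_lebesgue_integral_def abs_le_iff mult.commute)
qed

lemma LINT_Icc_shift:
  fixes g :: "real \<Rightarrow> real"
  shows "(LINT s:{a..b}|lborel. g (s + c)) = (LINT s:{a + c..b + c}|lborel. g s)"
  unfolding set_lebesgue_integral_def
  by (subst (2) lborel_integral_real_affine[where c = 1 and t = c])
     (auto intro!: Bochner_Integration.integral_cong split: split_indicator simp: add.commute)

lemma LINT_Icc_reflect:
  fixes g :: "real \<Rightarrow> real"
  shows "(LINT s:{0..t}|lborel. g (t - s)) = (LINT s:{0..t}|lborel. g s)"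
  unfolding set_lebesgue_integral_def
  by (subst (2) lborel_integral_real_affine[where c = "-1" and t = t])
     (auto intro!: Bochner_Integration.integral_cong split: split_indicator)

lemma LINT_Icc_split:
  fixes g :: "real \<Rightarrow> real"
  assumes "a \<le> b" "b \<le> c" and int: "set_integrable lborel {a..c} g"
  shows "(LINT s:{a..c}|lborel. g s) = (LINT s:{a..b}|lborel. g s) + (LINT s:{b..c}|lborel. g s)"
proof -
  have eq: "{a..c} = {a..b} \<union> {b..c}"
    using assms by auto
  have "AE s in lborel. \<not> (s \<in> {a..b} \<and> s \<in> {b..c})"
    using AE_lborel_singleton[of b] by eventually_elim auto
  then show ?thesis
    unfolding eq using assms(1,2)
    by (intro set_integral_Un_AE) (auto intro!: set_integrable_subset[OF int])
qed

lemma LINT_Icc_exp: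
  fixes c t :: real
  assumes "0 \<le> t"
  shows "(LINT s:{0..t}|lborel. c * exp (- c * s)) = 1 - exp (- c * t)"
    and "(LINT s:{0..t}|lborel. c * exp (c * (t - s))) = exp (c * t) - 1"
proof -
  have "integral\<^sup>L lborel (\<lambda>s. (c * exp (- c * s)) * indicator {0..t} s)
      = (- exp (- c * t)) - (- exp (- c * 0))"
    using assms by (intro integral_FTC_Icc_real) (auto intro!: derivative_eq_intros)
  then show "(LINT s:{0..t}|lborel. c * exp (- c * s)) = 1 - exp (- c * t)"
    unfolding set_lebesgue_integral_def real_scaleR_def by (simp only: mult.commute) simp
  have "integral\<^sup>L lborel (\<lambda>s. (c * exp (c * (t - s))) * indicator {0..t} s)
      = (- exp (c * (t - t))) - (- exp (c * (t - 0)))"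
    using assms by (intro integral_FTC_Icc_real) (auto intro!: derivative_eq_intros)
  then show "(LINT s:{0..t}|lborel. c * exp (c * (t - s))) = exp (c * t) - 1"
    unfolding set_lebesgue_integral_def real_scaleR_def by (simp only: mult.commute) simp
qed

lemma measurable_LINT_Icc:
  fixes h :: "'p \<Rightarrow> real \<Rightarrow> real" and a b :: "'p \<Rightarrow> real"
  assumes [measurable]: "(\<lambda>(p, s). h p s) \<in> borel_measurable (N \<Otimes>\<^sub>M borel)"
    "a \<in> borel_measurable N" "b \<in> borel_measurable N"
  shows "(\<lambda>p. LINT s:{a p..b p}|lborel. h p s) \<in> borel_measurable N"
proof -
  have *: "indicator {a p..b p} s = (if a p \<le> s \<and> s \<le> b p then 1 else 0 :: real)" for p s
    by (auto split: split_indicator)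
  have "(\<lambda>(p, s). (if a p \<le> s \<and> s \<le> b p then 1 else 0) *\<^sub>R h p s)
      \<in> borel_measurable (N \<Otimes>\<^sub>M lborel)"
    by measurable
  then show ?thesis
    unfolding set_lebesgue_integral_def * by (rule lborel.borel_measurable_lebesgue_integral)
qed

lemma (in prob_space) integral_LINT_Icc:
  fixes h :: "real \<Rightarrow> 'a \<Rightarrow> real"
  assumes h: "(\<lambda>(s, \<omega>). h s \<omega>) \<in> borel_measurable (borel \<Otimes>\<^sub>M M)"
    and bnd: "\<And>s \<omega>. s \<in> {a..b} \<Longrightarrow> \<bar>h s \<omega>\<bar> \<le> B"
  shows "(\<integral>\<omega>. (LINT s:{a..b}|lborel. h s \<omega>) \<partial>M) = (LINT s:{a..b}|lborel. (\<integral>\<omega>. h s \<omega> \<partial>M))"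
    and "integrable M (\<lambda>\<omega>. LINT s:{a..b}|lborel. h s \<omega>)"
proof -
  interpret pair_sigma_finite "lborel :: real measure" M ..
  have sets: "sets (lborel \<Otimes>\<^sub>M M) = sets (borel \<Otimes>\<^sub>M M)"
    by (intro sets_pair_measure_cong) simp_all
  have hm: "(\<lambda>(s, \<omega>). indicator {a..b} s * h s \<omega>) \<in> borel_measurable (lborel \<Otimes>\<^sub>M M)"
  proof (subst measurable_cong_sets[OF sets refl])
    have "(\<lambda>p. indicator {a..b} (fst p) :: real) \<in> borel_measurable (borel \<Otimes>\<^sub>M M)"
      by (rule measurable_compose[OF measurable_fst]) simp
    then show "(\<lambda>(s, \<omega>). indicator {a..b} s * h s \<omega>) \<in> borel_measurable (borel \<Otimes>\<^sub>M M)"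
      using h unfolding split_beta' by (rule borel_measurable_times)
  qed
  have int: "integrable (lborel \<Otimes>\<^sub>M M) (\<lambda>(s, \<omega>). indicator {a..b} s * h s \<omega>)"
  proof (rule Bochner_Integration.integrable_bound[OF _ hm])
    have "emeasure (lborel \<Otimes>\<^sub>M M) ({a..b} \<times> space M) < \<infinity>"
      by (subst sigma_finite_measure.emeasure_pair_measure_Times[OF prob_space_imp_sigma_finite[OF prob_space_axioms]])
        (auto simp: emeasure_space_1 emeasure_lborel_Icc_eq)
    then show "integrable (lborel \<Otimes>\<^sub>M M) (\<lambda>p. \<bar>B\<bar> * indicator ({a..b} \<times> space M) p)"
      by (intro integrable_mult_right integrable_real_indicator) auto
    have "\<bar>h s \<omega>\<bar> \<le> \<bar>B\<bar>" if "s \<in> {a..b}" for s \<omega>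
      using bnd[OF that, of \<omega>] by linarith
    then show "AE p in lborel \<Otimes>\<^sub>M M. norm (case p of (s, \<omega>) \<Rightarrow> indicator {a..b} s * h s \<omega>)
        \<le> norm (\<bar>B\<bar> * indicator ({a..b} \<times> space M) p)"
      by (intro AE_I2) (auto simp: space_pair_measure indicator_def)
  qed
  from Fubini_integral[OF int]
  show "(\<integral>\<omega>. (LINT s:{a..b}|lborel. h s \<omega>) \<partial>M) = (LINT s:{a..b}|lborel. (\<integral>\<omega>. h s \<omega> \<partial>M))"
    by (simp add: set_lebesgue_integral_def)
  from integrable_snd[OF int] show "integrable M (\<lambda>\<omega>. LINT s:{a..b}|lborel. h s \<omega>)"
    by (simp add: set_lebesgue_integral_def)
qed

text \<open>
  Integration by parts for a merely measurable \<open>g\<close>: exchange the order of integration on the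
  triangle \<open>s \<le> u\<close>, where the weight \<open>c e\<^sup>-\<^sup>c\<^sup>s\<close> has the primitive \<open>- e\<^sup>-\<^sup>c\<^sup>s\<close>.
\<close>

lemma LINT_Icc_exp_triangle:
  fixes g :: "real \<Rightarrow> real"
  assumes t: "0 \<le> t" and [measurable]: "g \<in> borel_measurable borel"
    and bnd: "\<And>u. u \<in> {0..t} \<Longrightarrow> \<bar>g u\<bar> \<le> B"
  shows "(LINT s:{0..t}|lborel. c * exp (- c * s) * (LINT u:{s..t}|lborel. g u))
      = (LINT u:{0..t}|lborel. (1 - exp (- c * u)) * g u)"
proof -
  define h where "h s u = (if 0 \<le> s \<and> s \<le> u \<and> u \<le> t then c * exp (- c * s) * g u else 0)"
    for s u :: real
  have hm: "(\<lambda>(s, u). h s u) \<in> borel_measurable (lborel \<Otimes>\<^sub>M lborel)"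
    unfolding h_def by measurable
  have hb: "\<bar>h s u\<bar> \<le> \<bar>c\<bar> * exp (\<bar>c\<bar> * t) * \<bar>B\<bar> * indicator ({0..t} \<times> {0..t}) (s, u)" for s u
  proof (cases "0 \<le> s \<and> s \<le> u \<and> u \<le> t")
    case True
    have "- c * s \<le> \<bar>c\<bar> * s"
      using True by (intro mult_right_mono) auto
    also have "\<dots> \<le> \<bar>c\<bar> * t"
      using True by (intro mult_left_mono) auto
    finally have "exp (- c * s) \<le> exp (\<bar>c\<bar> * t)"
      by simp
    moreover have "\<bar>g u\<bar> \<le> \<bar>B\<bar>"
      using bnd[of u] True by auto
    ultimately show ?thesis
      using True by (auto simp: h_def abs_mult intro!: mult_mono)
  qed (auto simp: h_def split: split_indicator)
  have fin: "emeasure (lborel \<Otimes>\<^sub>M lborel) ({0..t} \<times> {0..t}) < \<infinity>"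
    by (simp add: lborel.emeasure_pair_measure_Times t ennreal_mult_less_top)
  have "integrable (lborel \<Otimes>\<^sub>M lborel) (\<lambda>(s, u). h s u)"
  proof (rule Bochner_Integration.integrable_bound[OF _ hm])
    show "integrable (lborel \<Otimes>\<^sub>M lborel)
        (\<lambda>p. \<bar>c\<bar> * exp (\<bar>c\<bar> * t) * \<bar>B\<bar> * indicator ({0..t} \<times> {0..t}) p)"
      using fin by (intro integrable_mult_right integrable_real_indicator) auto
    show "AE p in lborel \<Otimes>\<^sub>M lborel. norm (case p of (s, u) \<Rightarrow> h s u)
        \<le> norm (\<bar>c\<bar> * exp (\<bar>c\<bar> * t) * \<bar>B\<bar> * indicator ({0..t} \<times> {0..t}) p)"
      using hb by (intro AE_I2) (auto simp: abs_mult split: prod.split)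
  qed
  then have "(LINT u|lborel. LINT s|lborel. h s u) = (LINT s|lborel. LINT u|lborel. h s u)"
    by (rule lborel_pair.Fubini_integral)
  moreover have "(LINT u|lborel. h s u)
      = indicator {0..t} s *\<^sub>R (c * exp (- c * s) * (LINT u:{s..t}|lborel. g u))" for s
  proof -
    have "(LINT u|lborel. h s u)
        = (LINT u|lborel. (indicator {0..t} s * (c * exp (- c * s))) * (indicator {s..t} u *\<^sub>R g u))"
      by (rule Bochner_Integration.integral_cong) (auto simp: h_def split: split_indicator)
    then show ?thesis
      by (simp add: set_lebesgue_integral_def)
  qed
  moreover have "(LINT s|lborel. h s u) = indicator {0..t} u *\<^sub>R ((1 - exp (- c * u)) * g u)" for u
  proof -
    have "(LINT s|lborel. h s u)
        = (LINT s|lborel. (indicator {0..t} u * g u) * (indicator {0..u} s *\<^sub>R (c * exp (- c * s))))"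
      by (rule Bochner_Integration.integral_cong) (auto simp: h_def split: split_indicator)
    also have "\<dots> = (indicator {0..t} u * g u) * (LINT s:{0..u}|lborel. c * exp (- c * s))"
      by (simp only: set_lebesgue_integral_def integral_mult_right_zero)
    finally show ?thesis
      using LINT_Icc_exp(1)[of u c] by (auto split: split_indicator)
  qed
  ultimately show ?thesis
    by (simp add: set_lebesgue_integral_def)
qed


section \<open>Markov kernels and Duhamel's formula\<close>

definition locally_bounded_field :: "(real \<Rightarrow> 'a::topological_space \<Rightarrow> real) \<Rightarrow> bool" where
  "locally_bounded_field v \<longleftrightarrow>
    (\<lambda>(t, x). v t x) \<in> borel_measurable (borel \<Otimes>\<^sub>M borel) \<and>
    (\<forall>T. \<exists>B. \<forall>t\<in>{0..T}. \<forall>x. \<bar>v t x\<bar> \<le> B)"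

lemma locally_bounded_fieldD:
  assumes "locally_bounded_field v"
  shows "(\<lambda>(t, x). v t x) \<in> borel_measurable (borel \<Otimes>\<^sub>M borel)"
    and "\<exists>B\<ge>0. \<forall>t\<in>{0..T}. \<forall>x. \<bar>v t x\<bar> \<le> B"
proof -
  show "(\<lambda>(t, x). v t x) \<in> borel_measurable (borel \<Otimes>\<^sub>M borel)"
    using assms by (simp add: locally_bounded_field_def)
  obtain B where "\<forall>t\<in>{0..T}. \<forall>x. \<bar>v t x\<bar> \<le> B"
    using assms unfolding locally_bounded_field_def by blast
  then show "\<exists>B\<ge>0. \<forall>t\<in>{0..T}. \<forall>x. \<bar>v t x\<bar> \<le> B"
    by (intro exI[of _ "max B 0"]) (auto intro: max.coboundedI1)
qed

text \<open>
  The comparison argument sees the process only through its transition kernels. Working with kernels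
  alone has a second benefit: the kernels of a motionless process are an instance, and for them
  the theory below is the theory of the ordinary differential equation.
\<close>

locale markov_kernels =
  fixes K :: "real \<Rightarrow> 'a::topological_space \<Rightarrow> 'a measure"
  assumes K_measurable: "(\<lambda>(t, x). K t x) \<in> borel \<Otimes>\<^sub>M borel \<rightarrow>\<^sub>M subprob_algebra borel"
    and prob_space_K: "prob_space (K t x)"
    and chapman_kolmogorov: "0 \<le> s \<Longrightarrow> 0 \<le> t \<Longrightarrow> K (s + t) x = K s x \<bind> K t"
begin

definition Q :: "real \<Rightarrow> ('a \<Rightarrow> real) \<Rightarrow> 'a \<Rightarrow> real" where
  "Q t g x = (\<integral>y. g y \<partial>K t x)"

lemma sets_K: "sets (K t x) = sets borel"
  using measurable_space[OF K_measurable, of "(t, x)"]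
  by (simp add: space_subprob_algebra space_pair_measure)

lemma K_measurable_snd: "K t \<in> borel \<rightarrow>\<^sub>M subprob_algebra borel"
proof -
  have "(\<lambda>x. (t, x)) \<in> borel \<rightarrow>\<^sub>M borel \<Otimes>\<^sub>M borel"
    by simp
  from measurable_compose[OF this K_measurable] show ?thesis
    by simp
qed

lemma integrable_K:
  fixes g :: "'a \<Rightarrow> real"
  assumes "g \<in> borel_measurable borel" "\<And>y. \<bar>g y\<bar> \<le> B"
  shows "integrable (K t x) g"
proof -
  interpret prob_space "K t x"
    by (rule prob_space_K)
  show ?thesis
    using assms by (intro integrable_const_bound[of _ B]) (auto simp: measurable_cong_sets[OF sets_K refl])
qed

lemma Q_const: "Q t (\<lambda>_. c) x = c"
  using prob_space.prob_space[OF prob_space_K] by (simp add: Q_def)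

lemma Q_cmult: "Q t (\<lambda>y. c * g y) x = (c :: real) * Q t g x"
  by (simp add: Q_def)

lemma Q_add:
  assumes "g \<in> borel_measurable borel" "\<And>y. \<bar>g y\<bar> \<le> B" "h \<in> borel_measurable borel" "\<And>y. \<bar>h y\<bar> \<le> C"
  shows "Q t (\<lambda>y. g y + h y) x = Q t g x + Q t h x"
  unfolding Q_def by (intro Bochner_Integration.integral_add integrable_K[OF assms(1,2)] integrable_K[OF assms(3,4)])

lemma Q_mono:
  assumes "g \<in> borel_measurable borel" "\<And>y. \<bar>g y\<bar> \<le> B" "h \<in> borel_measurable borel" "\<And>y. \<bar>h y\<bar> \<le> C"
    and "\<And>y. g y \<le> h y"
  shows "Q t g x \<le> Q t h x"
  unfolding Q_def by (intro integral_mono integrable_K[OF assms(1,2)] integrable_K[OF assms(3,4)] assms(5))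

lemma Q_abs_le:
  assumes "g \<in> borel_measurable borel" "\<And>y. \<bar>g y\<bar> \<le> B"
  shows "\<bar>Q t g x\<bar> \<le> B"
proof -
  have *: "(\<lambda>_. c) \<in> borel_measurable borel" "\<bar>c\<bar> \<le> \<bar>c\<bar>" for c :: real
    by auto
  have "Q t g x \<le> Q t (\<lambda>_. B) x"
    using assms(2) by (intro Q_mono[OF assms *]) (auto simp: abs_le_iff)
  moreover have "Q t (\<lambda>_. -B) x \<le> Q t g x"
    using assms(2) by (intro Q_mono[OF * assms]) (smt (verit))
  ultimately show ?thesis
    by (simp add: Q_const abs_le_iff)
qed

lemma measurable_Q:
  assumes h: "(\<lambda>(p, y). h p y) \<in> borel_measurable (N \<Otimes>\<^sub>M borel)"
    and [measurable]: "\<tau> \<in> borel_measurable N" "\<xi> \<in> N \<rightarrow>\<^sub>M borel"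
  shows "(\<lambda>p. Q (\<tau> p) (h p) (\<xi> p)) \<in> borel_measurable N"
proof -
  have "(\<lambda>p. (\<tau> p, \<xi> p)) \<in> N \<rightarrow>\<^sub>M borel \<Otimes>\<^sub>M borel"
    by measurable
  from measurable_compose[OF this K_measurable]
  have L: "(\<lambda>p. K (\<tau> p) (\<xi> p)) \<in> N \<rightarrow>\<^sub>M subprob_algebra borel"
    by simp
  note measurable_distr2[measurable]
  have [measurable]: "(\<lambda>p. K (\<tau> p) (\<xi> p)) \<in> N \<rightarrow>\<^sub>M subprob_algebra borel" by (rule L)
  have "(\<lambda>p. integral\<^sup>L (distr (K (\<tau> p) (\<xi> p)) (N \<Otimes>\<^sub>M borel) (\<lambda>y. (p, y))) (\<lambda>(p, y). h p y))
      \<in> borel_measurable N"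
    using h by measurable
  then show ?thesis
    unfolding Q_def
    by (rule measurable_cong[THEN iffD1, rotated])
       (subst integral_distr, use h in \<open>auto simp: measurable_cong_sets[OF sets_K refl]\<close>)
qed

lemma measurable_Q_fixed:
  assumes "g \<in> borel_measurable borel"
  shows "Q t g \<in> borel_measurable borel"
  using assms by (intro measurable_Q[where \<tau> = "\<lambda>_. t" and \<xi> = "\<lambda>x. x" and h = "\<lambda>_. g"]) auto

lemma Q_semigroup:
  assumes g: "g \<in> borel_measurable borel" "\<And>y. \<bar>g y\<bar> \<le> B" and "0 \<le> s" "0 \<le> t"
  shows "Q s (Q t g) x = Q (s + t) g x"
proof -
  interpret prob_space "K s x"
    by (rule prob_space_K)
  have "integral\<^sup>L (K s x \<bind> K t) g = (\<integral>y. integral\<^sup>L (K t y) g \<partial>K s x)"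
  proof (rule integral_bind[where K = borel and B = B and B' = 1])
    show "K t \<in> K s x \<rightarrow>\<^sub>M subprob_algebra borel"
      using K_measurable_snd by (simp add: measurable_cong_sets[OF sets_K refl])
    show "AE y in K s x. emeasure (K t y) (space (K t y)) \<le> ennreal 1"
      using prob_space.emeasure_space_1[OF prob_space_K] by simp
  qed (use g in \<open>auto intro: finite_measure_axioms\<close>)
  then show ?thesis
    using assms(3,4) by (simp add: Q_def chapman_kolmogorov)
qed

lemma Q_LINT:
  fixes h :: "real \<Rightarrow> 'a \<Rightarrow> real"
  assumes h: "(\<lambda>(s, y). h s y) \<in> borel_measurable (borel \<Otimes>\<^sub>M borel)"
    and bnd: "\<And>s y. s \<in> {a..b} \<Longrightarrow> \<bar>h s y\<bar> \<le> B"
  shows "Q t (\<lambda>y. LINT s:{a..b}|lborel. h s y) x = (LINT s:{a..b}|lborel. Q t (h s) x)"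
  unfolding Q_def
proof (rule prob_space.integral_LINT_Icc[OF prob_space_K])
  have sets: "sets (borel \<Otimes>\<^sub>M K t x) = sets (borel \<Otimes>\<^sub>M borel)"
    by (intro sets_pair_measure_cong) (simp_all add: sets_K)
  show "(\<lambda>(s, y). h s y) \<in> borel_measurable (borel \<Otimes>\<^sub>M K t x)"
    unfolding measurable_cong_sets[OF sets refl] by (rule h)
qed (rule bnd)

end

lemma lipschitz_real_measurable:
  fixes \<psi> :: "real \<Rightarrow> real"
  assumes "\<Lambda>-lipschitz_on UNIV \<psi>"
  shows "\<psi> \<in> borel_measurable borel"
  using lipschitz_on_continuous_on[OF assms] by (rule borel_measurable_continuous_onI)

lemma lipschitz_realD:
  fixes \<psi> :: "real \<Rightarrow> real"
  assumes "\<Lambda>-lipschitz_on UNIV \<psi>"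
  shows "\<bar>\<psi> a - \<psi> b\<bar> \<le> \<Lambda> * \<bar>a - b\<bar>"
  using lipschitz_onD[OF assms, of a b] by (simp add: dist_real_def)

lemma lipschitz_add_linear:
  fixes \<phi> :: "real \<Rightarrow> real"
  assumes lip: "L-lipschitz_on UNIV \<phi>"
  shows "(L + L)-lipschitz_on UNIV (\<lambda>r. \<phi> r + L * r)" and "mono (\<lambda>r. \<phi> r + L * r)"
proof -
  have L: "0 \<le> L"
    by (rule lipschitz_on_nonneg[OF lip])
  have "L-lipschitz_on UNIV (\<lambda>r. L * r)"
    using L by (intro lipschitz_onI) (auto simp: dist_real_def abs_mult simp flip: right_diff_distrib)
  with lip show "(L + L)-lipschitz_on UNIV (\<lambda>r. \<phi> r + L * r)"
    by (rule lipschitz_on_add)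
  show "mono (\<lambda>r. \<phi> r + L * r)"
  proof (rule monoI)
    fix a b :: real assume "a \<le> b"
    then show "\<phi> a + L * a \<le> \<phi> b + L * b"
      using lipschitz_realD[OF lip, of a b] by (simp add: algebra_simps abs_le_iff)
  qed
qed

lemma locally_bounded_field_lipschitz:
  assumes v: "locally_bounded_field v" and \<psi>: "\<Lambda>-lipschitz_on UNIV \<psi>"
  shows "locally_bounded_field (\<lambda>t x. \<psi> (v t x))"
  unfolding locally_bounded_field_def
proof (intro conjI allI)
  note [measurable] = locally_bounded_fieldD(1)[OF v] lipschitz_real_measurable[OF \<psi>]
  have "(\<lambda>p. \<psi> (case p of (t, x) \<Rightarrow> v t x)) \<in> borel_measurable (borel \<Otimes>\<^sub>M borel)"
    by measurable
  then show "(\<lambda>(t, x). \<psi> (v t x)) \<in> borel_measurable (borel \<Otimes>\<^sub>M borel)"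
    by (simp add: split_beta')
  fix T
  obtain B where B: "\<forall>t\<in>{0..T}. \<forall>x. \<bar>v t x\<bar> \<le> B"
    using locally_bounded_fieldD(2)[OF v] by blast
  have "\<bar>\<psi> (v t x)\<bar> \<le> \<bar>\<psi> 0\<bar> + \<Lambda> * B" if "t \<in> {0..T}" for t x
  proof -
    have "\<bar>\<psi> (v t x) - \<psi> 0\<bar> \<le> \<Lambda> * \<bar>v t x\<bar>"
      using lipschitz_realD[OF \<psi>, of "v t x" 0] by simp
    also have "\<dots> \<le> \<Lambda> * B"
      using B that lipschitz_on_nonneg[OF \<psi>] by (intro mult_left_mono) auto
    finally show ?thesis
      by linarith
  qed
  then show "\<exists>B. \<forall>t\<in>{0..T}. \<forall>x. \<bar>\<psi> (v t x)\<bar> \<le> B"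
    by blast
qed

lemma locally_bounded_field_section:
  assumes "locally_bounded_field v"
  shows "v t \<in> borel_measurable borel"
proof -
  have "(\<lambda>x. (t, x)) \<in> borel \<rightarrow>\<^sub>M borel \<Otimes>\<^sub>M borel"
    by simp
  from measurable_compose[OF this locally_bounded_fieldD(1)[OF assms]] show ?thesis
    by simp
qed

lemma locally_bounded_field_measurable_compose:
  assumes "locally_bounded_field v" "\<tau> \<in> borel_measurable N" "\<xi> \<in> N \<rightarrow>\<^sub>M borel"
  shows "(\<lambda>p. v (\<tau> p) (\<xi> p)) \<in> borel_measurable N"
  using measurable_compose[OF measurable_Pair[OF assms(2,3)] locally_bounded_fieldD(1)[OF assms(1)]]
  by simp

context markov_kernels
begin

text \<open>
  The right-hand side of the integral equation, after taking expectations under the time integral,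
  for the process killed at rate \<open>c\<close>. The equation of the evolution operator is the case \<open>c = 0\<close>;
  comparison of solutions is possible for large \<open>c\<close>.
\<close>

definition duhamel ::
  "real \<Rightarrow> (real \<Rightarrow> real) \<Rightarrow> ('a \<Rightarrow> real) \<Rightarrow> (real \<Rightarrow> 'a \<Rightarrow> real) \<Rightarrow> real \<Rightarrow> 'a \<Rightarrow> real" where
  "duhamel c \<psi> f v t x =
    exp (- c * t) * Q t f x
    + (LINT s:{0..t}|lborel. exp (- c * s) * Q s (\<lambda>y. \<psi> (v (t - s) y)) x)"

lemma duhamel_integrand:
  assumes v: "locally_bounded_field v" and \<psi>: "\<Lambda>-lipschitz_on UNIV \<psi>"
  obtains B where "0 \<le> B"
    "\<And>r y. \<lbrakk>0 \<le> r; r \<le> T\<rbrakk> \<Longrightarrow> \<bar>\<psi> (v r y)\<bar> \<le> B"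
    "\<And>s t x. 0 \<le> s \<Longrightarrow> s \<le> t \<Longrightarrow> t \<le> T \<Longrightarrow> \<bar>Q s (\<lambda>y. \<psi> (v (t - s) y)) x\<bar> \<le> B"
proof -
  note w = locally_bounded_field_lipschitz[OF v \<psi>]
  obtain B where B: "0 \<le> B" "\<forall>t\<in>{0..T}. \<forall>x. \<bar>\<psi> (v t x)\<bar> \<le> B"
    using locally_bounded_fieldD(2)[OF w] by blast
  show ?thesis
  proof (rule that[OF B(1)])
    show "\<bar>\<psi> (v r y)\<bar> \<le> B" if "0 \<le> r" "r \<le> T" for r y
      using B(2) that by auto
    show "\<bar>Q s (\<lambda>y. \<psi> (v (t - s) y)) x\<bar> \<le> B" if "0 \<le> s" "s \<le> t" "t \<le> T" for s t x
      using B(2) that by (intro Q_abs_le locally_bounded_field_section[OF w]) auto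
  qed
qed

lemma duhamel_integrand_measurable:
  assumes v: "locally_bounded_field v" and \<psi>: "\<Lambda>-lipschitz_on UNIV \<psi>"
  shows "(\<lambda>s. Q s (\<lambda>y. \<psi> (v (t - s) y)) x) \<in> borel_measurable borel"
proof (rule measurable_Q)
  note w = locally_bounded_field_lipschitz[OF v \<psi>]
  show "(\<lambda>(s, y). \<psi> (v (t - s) y)) \<in> borel_measurable (borel \<Otimes>\<^sub>M borel)"
    unfolding split_beta' by (rule locally_bounded_field_measurable_compose[OF w]) auto
qed auto

lemma duhamel_set_integrable:
  assumes v: "locally_bounded_field v" and \<psi>: "\<Lambda>-lipschitz_on UNIV \<psi>"
    and "0 \<le> c" "0 \<le> a" "b \<le> t"
  shows "set_integrable lborel {a..b} (\<lambda>s. exp (- c * s) * Q s (\<lambda>y. \<psi> (v (t - s) y)) x)"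
proof -
  obtain B where B: "0 \<le> B"
    "\<And>s t' y. 0 \<le> s \<Longrightarrow> s \<le> t' \<Longrightarrow> t' \<le> t \<Longrightarrow> \<bar>Q s (\<lambda>y. \<psi> (v (t' - s) y)) x\<bar> \<le> B"
    using duhamel_integrand[OF v \<psi>, of t] by metis
  note [measurable] = duhamel_integrand_measurable[OF v \<psi>]
  show ?thesis
  proof (rule set_integrable_bounded_Icc)
    fix s assume s: "s \<in> {a..b}"
    have "\<bar>exp (- c * s)\<bar> * \<bar>Q s (\<lambda>y. \<psi> (v (t - s) y)) x\<bar> \<le> 1 * B"
      using s assms by (intro mult_mono B) auto
    then show "\<bar>exp (- c * s) * Q s (\<lambda>y. \<psi> (v (t - s) y)) x\<bar> \<le> B"
      by (simp add: abs_mult)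
  qed measurable
qed

lemma locally_bounded_field_duhamel:
  assumes v: "locally_bounded_field v" and \<psi>: "\<Lambda>-lipschitz_on UNIV \<psi>"
    and f: "f \<in> borel_measurable borel" "\<And>y. \<bar>f y\<bar> \<le> C"
  shows "locally_bounded_field (duhamel 0 \<psi> f v)"
  unfolding locally_bounded_field_def
proof (intro conjI allI)
  note w = locally_bounded_field_lipschitz[OF v \<psi>]
  have [measurable]: "(\<lambda>p. Q (fst p) f (snd p)) \<in> borel_measurable (borel \<Otimes>\<^sub>M borel)"
    by (rule measurable_Q[where h = "\<lambda>_. f"]) (use f in auto)
  have "(\<lambda>q. Q (snd q) (\<lambda>y. \<psi> (v (fst (fst q) - snd q) y)) (snd (fst q)))
      \<in> borel_measurable ((borel \<Otimes>\<^sub>M borel) \<Otimes>\<^sub>M borel)"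
  proof (rule measurable_Q[where h = "\<lambda>q y. \<psi> (v (fst (fst q) - snd q) y)"])
    show "(\<lambda>(q, y). \<psi> (v (fst (fst q) - snd q) y))
        \<in> borel_measurable (((borel \<Otimes>\<^sub>M (borel :: 'a measure)) \<Otimes>\<^sub>M borel) \<Otimes>\<^sub>M borel)"
      unfolding split_beta' by (rule locally_bounded_field_measurable_compose[OF w]) measurable
  qed measurable
  then have "(\<lambda>p. LINT s:{0..fst p}|lborel. Q s (\<lambda>y. \<psi> (v (fst p - s) y)) (snd p))
      \<in> borel_measurable (borel \<Otimes>\<^sub>M borel)"
    by (intro measurable_LINT_Icc) (auto simp: split_beta')
  then have "(\<lambda>p. Q (fst p) f (snd p)
      + (LINT s:{0..fst p}|lborel. Q s (\<lambda>y. \<psi> (v (fst p - s) y)) (snd p)))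
      \<in> borel_measurable (borel \<Otimes>\<^sub>M borel)"
    by (intro borel_measurable_add) measurable
  then show "(\<lambda>(t, x). duhamel 0 \<psi> f v t x) \<in> borel_measurable (borel \<Otimes>\<^sub>M borel)"
    by (simp add: duhamel_def split_beta')
  fix T
  obtain B where B: "0 \<le> B"
    "\<And>s t x. 0 \<le> s \<Longrightarrow> s \<le> t \<Longrightarrow> t \<le> T \<Longrightarrow> \<bar>Q s (\<lambda>y. \<psi> (v (t - s) y)) x\<bar> \<le> B"
    using duhamel_integrand[OF v \<psi>, of T] by metis
  have "\<bar>duhamel 0 \<psi> f v t x\<bar> \<le> C + T * B" if t: "t \<in> {0..T}" for t x
  proof -
    have "\<bar>LINT s:{0..t}|lborel. Q s (\<lambda>y. \<psi> (v (t - s) y)) x\<bar> \<le> (t - 0) * B"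
      using t by (intro LINT_Icc_abs_le duhamel_integrand_measurable[OF v \<psi>] B) auto
    also have "\<dots> \<le> T * B"
      using t B by (simp add: mult_right_mono)
    finally show ?thesis
      using Q_abs_le[OF f, of t x] by (simp add: duhamel_def)
  qed
  then show "\<exists>B. \<forall>t\<in>{0..T}. \<forall>x. \<bar>duhamel 0 \<psi> f v t x\<bar> \<le> B"
    by blast
qed

text \<open>
  Measuring the gap between two fields against \<open>e\<^sup>2\<^sup>\<Lambda>\<^sup>t\<close>, where \<open>\<Lambda>\<close> is a Lipschitz constant of the
  reaction, makes Duhamel's operator a contraction with factor \<open>1/2\<close> on the whole half-line. The
  one-sided form serves both the comparison principle and Picard iteration.
\<close>

lemma duhamel_gap_halved:
  assumes u: "locally_bounded_field u" and w: "locally_bounded_field w"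
    and \<psi>: "\<Lambda>-lipschitz_on UNIV \<psi>" and "0 \<le> c" "0 \<le> t" "0 \<le> \<delta>"
    and gap: "\<And>s y. 0 \<le> s \<Longrightarrow> s \<le> t \<Longrightarrow> \<psi> (u s y) \<le> \<psi> (w s y) + \<Lambda> * (\<delta> * exp (2 * \<Lambda> * s))"
  shows "duhamel c \<psi> f u t x \<le> duhamel c \<psi> f w t x + \<delta> / 2 * exp (2 * \<Lambda> * t)"
proof -
  have \<Lambda>: "0 \<le> \<Lambda>"
    by (rule lipschitz_on_nonneg[OF \<psi>])
  let ?\<epsilon> = "\<lambda>s. \<Lambda> * (\<delta> * exp (2 * \<Lambda> * (t - s)))"
  obtain B where B: "\<And>r y. \<lbrakk>0 \<le> r; r \<le> t\<rbrakk> \<Longrightarrow> \<bar>\<psi> (u r y)\<bar> \<le> B"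
    using duhamel_integrand[OF u \<psi>, of t] by metis
  obtain C where C: "\<And>r y. \<lbrakk>0 \<le> r; r \<le> t\<rbrakk> \<Longrightarrow> \<bar>\<psi> (w r y)\<bar> \<le> C"
    using duhamel_integrand[OF w \<psi>, of t] by metis
  note mu = locally_bounded_field_section[OF locally_bounded_field_lipschitz[OF u \<psi>]]
    and mw = locally_bounded_field_section[OF locally_bounded_field_lipschitz[OF w \<psi>]]
  note iu = duhamel_set_integrable[OF u \<psi> \<open>0 \<le> c\<close> order_refl order_refl]
    and iw = duhamel_set_integrable[OF w \<psi> \<open>0 \<le> c\<close> order_refl order_refl]
  have ie: "set_integrable lborel {0..t} ?\<epsilon>"
    by (intro borel_integrable_atLeastAtMost' continuous_intros)
  have "(LINT s:{0..t}|lborel. exp (- c * s) * Q s (\<lambda>y. \<psi> (u (t - s) y)) x)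
      \<le> (LINT s:{0..t}|lborel. exp (- c * s) * Q s (\<lambda>y. \<psi> (w (t - s) y)) x + ?\<epsilon> s)"
  proof (rule set_integral_mono[OF iu set_integral_add(1)[OF iw ie]])
    fix s assume s: "s \<in> {0..t}"
    then have r: "0 \<le> t - s" "t - s \<le> t"
      by auto
    have \<epsilon>: "0 \<le> ?\<epsilon> s"
      using \<Lambda> \<open>0 \<le> \<delta>\<close> by simp
    have "Q s (\<lambda>y. \<psi> (u (t - s) y)) x \<le> Q s (\<lambda>y. \<psi> (w (t - s) y) + ?\<epsilon> s) x"
    proof (rule Q_mono[OF mu B[OF r] _ _ gap[OF r]])
      show "(\<lambda>y. \<psi> (w (t - s) y) + ?\<epsilon> s) \<in> borel_measurable borel"
        using mw by (intro borel_measurable_add) auto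
      show "\<bar>\<psi> (w (t - s) y) + ?\<epsilon> s\<bar> \<le> C + ?\<epsilon> s" for y
        using C[OF r, of y] \<epsilon> by linarith
    qed
    also have "\<dots> = Q s (\<lambda>y. \<psi> (w (t - s) y)) x + Q s (\<lambda>y. ?\<epsilon> s) x"
      by (rule Q_add[OF mw C[OF r], where C = "?\<epsilon> s"]) (use \<epsilon> in auto)
    finally have "exp (- c * s) * Q s (\<lambda>y. \<psi> (u (t - s) y)) x
        \<le> exp (- c * s) * (Q s (\<lambda>y. \<psi> (w (t - s) y)) x + ?\<epsilon> s)"
      by (simp add: Q_const)
    moreover have "exp (- c * s) * ?\<epsilon> s \<le> 1 * ?\<epsilon> s"
      using s \<open>0 \<le> c\<close> \<epsilon> by (intro mult_right_mono) auto
    ultimately show "exp (- c * s) * Q s (\<lambda>y. \<psi> (u (t - s) y)) x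
        \<le> exp (- c * s) * Q s (\<lambda>y. \<psi> (w (t - s) y)) x + ?\<epsilon> s"
      by (simp add: distrib_left)
  qed
  also have "\<dots> = (LINT s:{0..t}|lborel. exp (- c * s) * Q s (\<lambda>y. \<psi> (w (t - s) y)) x)
      + (LINT s:{0..t}|lborel. ?\<epsilon> s)"
    by (rule set_integral_add(2)[OF iw ie])
  also have "(LINT s:{0..t}|lborel. ?\<epsilon> s)
      = \<delta> / 2 * (LINT s:{0..t}|lborel. 2 * \<Lambda> * exp (2 * \<Lambda> * (t - s)))"
    by (subst set_integral_mult_right[symmetric]) (simp add: mult_ac)
  also have "\<dots> = \<delta> / 2 * (exp (2 * \<Lambda> * t) - 1)"
    by (simp only: LINT_Icc_exp(2)[OF \<open>0 \<le> t\<close>])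
  also have "\<dots> \<le> \<delta> / 2 * exp (2 * \<Lambda> * t)"
    using \<open>0 \<le> \<delta>\<close> by (intro mult_left_mono) auto
  finally show ?thesis
    by (simp add: duhamel_def)
qed

text \<open>
  For a nondecreasing reaction only the positive part of \<open>u - w\<close> can feed the gap, so iterating the
  halving shrinks every upper bound for \<open>u - w\<close> to \<open>0\<close>.
\<close>

lemma duhamel_comparison:
  assumes u: "locally_bounded_field u" and w: "locally_bounded_field w"
    and \<psi>: "\<Lambda>-lipschitz_on UNIV \<psi>" and mono: "mono \<psi>" and "0 \<le> c"
    and sub: "\<And>t x. 0 \<le> t \<Longrightarrow> u t x \<le> duhamel c \<psi> f u t x"
    and super: "\<And>t x. 0 \<le> t \<Longrightarrow> duhamel c \<psi> f w t x \<le> w t x"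
    and "0 \<le> t"
  shows "u t x \<le> w t x"
proof -
  have \<Lambda>: "0 \<le> \<Lambda>"
    by (rule lipschitz_on_nonneg[OF \<psi>])
  obtain B where B: "B \<ge> 0" "\<forall>s\<in>{0..t}. \<forall>y. \<bar>u s y\<bar> \<le> B"
    using locally_bounded_fieldD(2)[OF u] by blast
  obtain C where C: "C \<ge> 0" "\<forall>s\<in>{0..t}. \<forall>y. \<bar>w s y\<bar> \<le> C"
    using locally_bounded_fieldD(2)[OF w] by blast
  have gap: "u s y \<le> w s y + (B + C) * (1 / 2) ^ k * exp (2 * \<Lambda> * s)" if "s \<in> {0..t}" for k s y
    using that
  proof (induction k arbitrary: s y)
    case 0
    have "B + C \<le> (B + C) * exp (2 * \<Lambda> * s)"
      using B(1) C(1) \<Lambda> 0 by (simp add: mult_le_cancel_left1)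
    moreover have "\<bar>u s y\<bar> \<le> B" "\<bar>w s y\<bar> \<le> C"
      using B C 0 by auto
    ultimately show ?case
      by simp
  next
    case (Suc k)
    let ?\<delta> = "(B + C) * (1 / 2) ^ k"
    have \<delta>: "0 \<le> ?\<delta>"
      using B(1) C(1) by simp
    have "u s y \<le> duhamel c \<psi> f u s y"
      using Suc.prems by (intro sub) auto
    also have "\<dots> \<le> duhamel c \<psi> f w s y + ?\<delta> / 2 * exp (2 * \<Lambda> * s)"
    proof (rule duhamel_gap_halved[OF u w \<psi> \<open>0 \<le> c\<close> _ \<delta>])
      fix r z assume r: "0 \<le> r" "r \<le> s"
      let ?d = "?\<delta> * exp (2 * \<Lambda> * r)"
      have "u r z \<le> w r z + ?d"
        using Suc.IH[of r z] r Suc.prems by auto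
      then have "\<psi> (u r z) \<le> \<psi> (w r z + ?d)"
        by (rule monoD[OF mono])
      also have "\<dots> \<le> \<psi> (w r z) + \<Lambda> * \<bar>?d\<bar>"
        using lipschitz_realD[OF \<psi>, of "w r z + ?d" "w r z"] by simp
      also have "\<bar>?d\<bar> = ?d"
        using \<delta> by simp
      finally show "\<psi> (u r z) \<le> \<psi> (w r z) + \<Lambda> * (?\<delta> * exp (2 * \<Lambda> * r))" .
    qed (use Suc.prems in auto)
    also have "duhamel c \<psi> f w s y \<le> w s y"
      using Suc.prems by (intro super) auto
    finally show ?case
      by simp
  qed
  have "(\<lambda>k. w t x + (B + C) * (1 / 2) ^ k * exp (2 * \<Lambda> * t)) \<longlonglongrightarrow> w t x + (B + C) * 0 * exp (2 * \<Lambda> * t)"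
    by (intro tendsto_intros LIMSEQ_power_zero) auto
  then show ?thesis
    using gap[of t x] \<open>0 \<le> t\<close> by (intro LIMSEQ_le_const) auto
qed

end

section \<open>Mild solutions\<close>

context markov_kernels
begin

lemma duhamel_contraction:
  assumes u: "locally_bounded_field u" and w: "locally_bounded_field w"
    and \<psi>: "\<Lambda>-lipschitz_on UNIV \<psi>" and "0 \<le> c" "0 \<le> t" "0 \<le> \<delta>"
    and gap: "\<And>s y. 0 \<le> s \<Longrightarrow> s \<le> t \<Longrightarrow> \<bar>u s y - w s y\<bar> \<le> \<delta> * exp (2 * \<Lambda> * s)"
  shows "\<bar>duhamel c \<psi> f u t x - duhamel c \<psi> f w t x\<bar> \<le> \<delta> / 2 * exp (2 * \<Lambda> * t)"
proof -
  have *: "\<bar>\<psi> (u s y) - \<psi> (w s y)\<bar> \<le> \<Lambda> * (\<delta> * exp (2 * \<Lambda> * s))" if "0 \<le> s" "s \<le> t" for s y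
  proof -
    have "\<Lambda> * \<bar>u s y - w s y\<bar> \<le> \<Lambda> * (\<delta> * exp (2 * \<Lambda> * s))"
      using gap[OF that] lipschitz_on_nonneg[OF \<psi>] by (intro mult_left_mono) auto
    then show ?thesis
      using lipschitz_realD[OF \<psi>, of "u s y" "w s y"] by linarith
  qed
  have "duhamel c \<psi> f u t x \<le> duhamel c \<psi> f w t x + \<delta> / 2 * exp (2 * \<Lambda> * t)"
    using *[THEN abs_le_D1] by (intro duhamel_gap_halved[OF u w \<psi> assms(4-6)]) (simp add: algebra_simps)
  moreover have "duhamel c \<psi> f w t x \<le> duhamel c \<psi> f u t x + \<delta> / 2 * exp (2 * \<Lambda> * t)"
    using *[THEN abs_le_D2] by (intro duhamel_gap_halved[OF w u \<psi> assms(4-6)]) (simp add: algebra_simps)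
  ultimately show ?thesis
    by linarith
qed

definition mild_solution :: "(real \<Rightarrow> real) \<Rightarrow> ('a \<Rightarrow> real) \<Rightarrow> (real \<Rightarrow> 'a \<Rightarrow> real) \<Rightarrow> bool" where
  "mild_solution \<phi> f v \<longleftrightarrow>
    locally_bounded_field v \<and> (\<forall>t\<ge>0. \<forall>x. v t x = duhamel 0 \<phi> f v t x)"

lemma mild_solutionD:
  assumes "mild_solution \<phi> f v"
  shows "locally_bounded_field v"
    and "0 \<le> t \<Longrightarrow> v t x
      = Q t f x + (LINT s:{0..t}|lborel. Q s (\<lambda>y. \<phi> (v (t - s) y)) x)"
proof -
  show "locally_bounded_field v"
    using assms by (simp add: mild_solution_def)
  assume "0 \<le> t"
  then have "v t x = duhamel 0 \<phi> f v t x"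
    using assms unfolding mild_solution_def by blast
  also have "\<dots> = Q t f x + (LINT s:{0..t}|lborel. Q s (\<lambda>y. \<phi> (v (t - s) y)) x)"
    by (simp add: duhamel_def)
  finally show "v t x = Q t f x + (LINT s:{0..t}|lborel. Q s (\<lambda>y. \<phi> (v (t - s) y)) x)" .
qed

text \<open>
  Picard iteration from the zero field: consecutive iterates differ by \<open>O(2\<^sup>-\<^sup>k e\<^sup>2\<^sup>\<Lambda>\<^sup>t)\<close>, uniformly
  in space.
\<close>

lemma mild_solution_exists:
  assumes lip: "L-lipschitz_on UNIV \<phi>"
    and f: "f \<in> borel_measurable borel" "\<And>y. \<bar>f y\<bar> \<le> C"
  shows "\<exists>v. mild_solution \<phi> f v"
proof -
  \<comment> \<open>a constant at least \<open>1\<close>, so that \<open>t \<le> e\<^sup>2\<^sup>\<Lambda>\<^sup>t\<close>\<close>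
  define \<Lambda> where "\<Lambda> = L + 1"
  have \<phi>: "\<Lambda>-lipschitz_on UNIV \<phi>" and \<Lambda>: "1 \<le> \<Lambda>"
    using lipschitz_on_le[OF lip] lipschitz_on_nonneg[OF lip] by (auto simp: \<Lambda>_def)
  define p where "p k = (duhamel 0 \<phi> f ^^ k) (\<lambda>_ _. 0)" for k
  have p0: "p 0 = (\<lambda>_ _. 0)" and pS: "p (Suc k) = duhamel 0 \<phi> f (p k)" for k
    by (auto simp: p_def)
  have p: "locally_bounded_field (p k)" for k
  proof (induction k)
    case 0
    show ?case
      by (auto simp: p0 locally_bounded_field_def)
  next
    case (Suc k)
    show ?case
      unfolding pS by (rule locally_bounded_field_duhamel[OF Suc \<phi> f])
  qed
  \<comment> \<open>the first iterate is at most \<open>C + t \<bar>\<phi> 0\<bar>\<close> in absolute value\<close>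
  define D where "D = C + \<bar>\<phi> 0\<bar>"
  have "0 \<le> C"
    using f(2)[of undefined] by linarith
  then have D: "0 \<le> D"
    by (simp add: D_def)
  have step: "\<bar>p (Suc k) t x - p k t x\<bar> \<le> D * (1 / 2) ^ k * exp (2 * \<Lambda> * t)" if "0 \<le> t" for k t x
    using that
  proof (induction k arbitrary: t x)
    case 0
    have e: "1 \<le> exp (2 * \<Lambda> * t)" "t \<le> exp (2 * \<Lambda> * t)"
    proof -
      have "1 * t \<le> 2 * \<Lambda> * t"
        using \<Lambda> 0 by (intro mult_right_mono) auto
      then show "t \<le> exp (2 * \<Lambda> * t)"
        using exp_ge_add_one_self[of "2 * \<Lambda> * t"] by linarith
    qed (use 0 \<Lambda> in simp)
    have "\<bar>Q t f x\<bar> \<le> C * exp (2 * \<Lambda> * t)"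
      using Q_abs_le[OF f, of t x] mult_left_mono[OF e(1) \<open>0 \<le> C\<close>] by simp
    moreover have "\<bar>LINT s:{0..t}|lborel. \<phi> 0\<bar> \<le> (t - 0) * \<bar>\<phi> 0\<bar>"
      using 0 by (intro LINT_Icc_abs_le) auto
    moreover have "t * \<bar>\<phi> 0\<bar> \<le> exp (2 * \<Lambda> * t) * \<bar>\<phi> 0\<bar>"
      using e(2) by (rule mult_right_mono) simp
    ultimately show ?case
      by (simp add: pS p0 duhamel_def Q_const D_def algebra_simps)
  next
    case (Suc k)
    have "\<bar>duhamel 0 \<phi> f (p (Suc k)) t x - duhamel 0 \<phi> f (p k) t x\<bar>
        \<le> (D * (1 / 2) ^ k) / 2 * exp (2 * \<Lambda> * t)"
      using Suc D by (intro duhamel_contraction[OF p p \<phi>]) auto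
    then show ?case
      by (simp add: pS)
  qed
  define v where "v t x = lim (\<lambda>k. p k t x)" for t x
  have lim: "(\<lambda>k. p k t x) \<longlonglongrightarrow> v t x" if t: "0 \<le> t" for t x
  proof -
    have "summable (\<lambda>k. p (Suc k) t x - p k t x)"
    proof (rule summable_comparison_test')
      show "summable (\<lambda>k. D * exp (2 * \<Lambda> * t) * (1 / 2) ^ k)"
        by (intro summable_mult summable_geometric) auto
      show "norm (p (Suc k) t x - p k t x) \<le> D * exp (2 * \<Lambda> * t) * (1 / 2) ^ k" for k
        using step[OF t, of k x] by (simp add: mult_ac)
    qed
    moreover have "(\<Sum>n<k. p (Suc n) t x - p n t x) = p k t x" for k
      using sum_lessThan_telescope[of "\<lambda>k. p k t x" k] by (simp add: p0)
    ultimately have "convergent (\<lambda>k. p k t x)"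
      by (simp only: summable_iff_convergent)
    then show ?thesis
      unfolding v_def by (simp add: convergent_LIMSEQ_iff)
  qed
  have tail: "\<bar>p (k + m) t x - p k t x\<bar> \<le> 2 * (D * (1 / 2) ^ k) * exp (2 * \<Lambda> * t) * (1 - (1 / 2) ^ m)"
    if t: "0 \<le> t" for k m t x
  proof (induction m)
    case (Suc m)
    have "\<bar>p (Suc (k + m)) t x - p (k + m) t x\<bar> \<le> D * (1 / 2) ^ (k + m) * exp (2 * \<Lambda> * t)"
      by (rule step[OF t])
    with Suc show ?case
      by (simp add: power_add algebra_simps)
  qed simp
  have v_p: "\<bar>v t x - p k t x\<bar> \<le> 2 * (D * (1 / 2) ^ k) * exp (2 * \<Lambda> * t)" if t: "0 \<le> t" for k t x
  proof (rule LIMSEQ_le_const2)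
    have "(\<lambda>m. p (m + k) t x) \<longlonglongrightarrow> v t x"
      by (rule LIMSEQ_ignore_initial_segment[OF lim[OF t]])
    then show "(\<lambda>m. \<bar>p (m + k) t x - p k t x\<bar>) \<longlonglongrightarrow> \<bar>v t x - p k t x\<bar>"
      by (intro tendsto_intros)
    have "\<bar>p (m + k) t x - p k t x\<bar> \<le> 2 * (D * (1 / 2) ^ k) * exp (2 * \<Lambda> * t)" for m
    proof -
      have "\<bar>p (k + m) t x - p k t x\<bar>
          \<le> 2 * (D * (1 / 2) ^ k) * exp (2 * \<Lambda> * t) * (1 - (1 / 2) ^ m)"
        by (rule tail[OF t])
      also have "\<dots> \<le> 2 * (D * (1 / 2) ^ k) * exp (2 * \<Lambda> * t) * 1"
        using D by (intro mult_left_mono) auto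
      finally show ?thesis
        by (simp only: add.commute[of m k] mult_1_right)
    qed
    then show "\<exists>N. \<forall>m\<ge>N. \<bar>p (m + k) t x - p k t x\<bar> \<le> 2 * (D * (1 / 2) ^ k) * exp (2 * \<Lambda> * t)"
      by (intro exI allI impI)
  qed
  have v: "locally_bounded_field v"
    unfolding locally_bounded_field_def
  proof (intro conjI allI)
    have "(\<lambda>q. lim (\<lambda>k. (\<lambda>(t, x). p k t x) q)) \<in> borel_measurable (borel \<Otimes>\<^sub>M borel)"
      by (intro borel_measurable_lim_metric locally_bounded_fieldD(1)[OF p])
    then show "(\<lambda>(t, x). v t x) \<in> borel_measurable (borel \<Otimes>\<^sub>M borel)"
      by (simp add: v_def split_beta')
    have "\<bar>v t x\<bar> \<le> 2 * D * exp (2 * \<Lambda> * T)" if t: "t \<in> {0..T}" for T t x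
    proof -
      have "\<bar>v t x\<bar> \<le> 2 * D * exp (2 * \<Lambda> * t)"
        using v_p[of t x 0] t by (simp add: p0)
      also have "\<dots> \<le> 2 * D * exp (2 * \<Lambda> * T)"
        using t D \<Lambda> by (intro mult_left_mono) auto
      finally show ?thesis .
    qed
    then show "\<exists>B. \<forall>t\<in>{0..T}. \<forall>x. \<bar>v t x\<bar> \<le> B" for T
      by blast
  qed
  have "v t x = duhamel 0 \<phi> f v t x" if t: "0 \<le> t" for t x
  proof -
    have "\<bar>duhamel 0 \<phi> f v t x - p (Suc k) t x\<bar> \<le> D * exp (2 * \<Lambda> * t) * (1 / 2) ^ k" for k
    proof -
      have "\<bar>duhamel 0 \<phi> f v t x - duhamel 0 \<phi> f (p k) t x\<bar>
          \<le> (2 * (D * (1 / 2) ^ k)) / 2 * exp (2 * \<Lambda> * t)"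
        using t D v_p by (intro duhamel_contraction[OF v p \<phi>]) auto
      then show ?thesis
        by (simp add: pS mult_ac)
    qed
    then have "\<forall>\<^sub>F k in sequentially.
        norm (duhamel 0 \<phi> f v t x - p (Suc k) t x) \<le> D * exp (2 * \<Lambda> * t) * (1 / 2) ^ k"
      by simp
    moreover have "(\<lambda>k. D * exp (2 * \<Lambda> * t) * (1 / 2) ^ k) \<longlonglongrightarrow> 0"
      by (rule tendsto_mult_right_zero) (simp add: LIMSEQ_power_zero)
    ultimately have "(\<lambda>k. duhamel 0 \<phi> f v t x - p (Suc k) t x) \<longlonglongrightarrow> 0"
      by (rule Lim_null_comparison)
    moreover have "(\<lambda>k. duhamel 0 \<phi> f v t x - p (Suc k) t x) \<longlonglongrightarrow> duhamel 0 \<phi> f v t x - v t x"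
      by (intro tendsto_intros LIMSEQ_Suc lim t)
    ultimately have "0 = duhamel 0 \<phi> f v t x - v t x"
      by (rule LIMSEQ_unique)
    then show ?thesis
      by simp
  qed
  with v show ?thesis
    unfolding mild_solution_def by blast
qed

text \<open>
  Applying \<open>Q\<^sub>s\<close> to a solution at time \<open>t - s\<close> merges with every kernel in Duhamel's formula, by the
  semigroup law, and so shifts the range of integration from \<open>[0, t - s]\<close> to \<open>[s, t]\<close>. Absorbing a
  decay rate and restarting a solution both rest on this identity.
\<close>

lemma mild_solution_propagate:
  assumes lip: "L-lipschitz_on UNIV \<phi>"
    and f: "f \<in> borel_measurable borel" "\<And>y. \<bar>f y\<bar> \<le> C"
    and sol: "mild_solution \<phi> f v" and s: "0 \<le> s" "s \<le> t"
  shows "Q s (v (t - s)) x = Q t f x + (LINT u:{s..t}|lborel. Q u (\<lambda>y. \<phi> (v (t - u) y)) x)"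
proof -
  note v = mild_solutionD(1)[OF sol]
  note w = locally_bounded_field_lipschitz[OF v lip]
  define h where "h r y = Q r (\<lambda>z. \<phi> (v (t - s - r) z)) y" for r y
  obtain B where B: "0 \<le> B"
    "\<And>r y. \<lbrakk>0 \<le> r; r \<le> t\<rbrakk> \<Longrightarrow> \<bar>\<phi> (v r y)\<bar> \<le> B"
    "\<And>r t' x. 0 \<le> r \<Longrightarrow> r \<le> t' \<Longrightarrow> t' \<le> t \<Longrightarrow> \<bar>Q r (\<lambda>y. \<phi> (v (t' - r) y)) x\<bar> \<le> B"
    using duhamel_integrand[OF v lip, of t] by metis
  have hm: "(\<lambda>(r, y). h r y) \<in> borel_measurable (borel \<Otimes>\<^sub>M borel)"
  proof -
    have "(\<lambda>q. Q (fst q) (\<lambda>z. \<phi> (v (t - s - fst q) z)) (snd q)) \<in> borel_measurable (borel \<Otimes>\<^sub>M borel)"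
    proof (rule measurable_Q[where h = "\<lambda>q z. \<phi> (v (t - s - fst q) z)"])
      show "(\<lambda>(q, z). \<phi> (v (t - s - fst q) z)) \<in> borel_measurable ((borel \<Otimes>\<^sub>M (borel :: 'a measure)) \<Otimes>\<^sub>M borel)"
        unfolding split_beta' by (rule locally_bounded_field_measurable_compose[OF w]) measurable
    qed measurable
    then show ?thesis
      by (simp add: h_def split_beta')
  qed
  have hb: "\<bar>h r y\<bar> \<le> B" if "r \<in> {0..t - s}" for r y
    unfolding h_def using that s by (intro B) auto
  have hs: "(\<lambda>r. h r y) \<in> borel_measurable borel" for y
    unfolding h_def by (rule duhamel_integrand_measurable[OF v lip])
  have vts: "v (t - s) = (\<lambda>y. Q (t - s) f y + (LINT r:{0..t - s}|lborel. h r y))"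
    using s by (intro ext, subst mild_solutionD(2)[OF sol]) (auto simp: h_def)
  have "Q s (v (t - s)) x = Q s (Q (t - s) f) x + Q s (\<lambda>y. LINT r:{0..t - s}|lborel. h r y) x"
    unfolding vts
  proof (rule Q_add[where B = C and C = "(t - s - 0) * B"])
    show "Q (t - s) f \<in> borel_measurable borel" "\<bar>Q (t - s) f y\<bar> \<le> C" for y
      by (rule measurable_Q_fixed[OF f(1)]) (rule Q_abs_le[OF f])
    have "(\<lambda>(y, r). h r y) \<in> borel_measurable (borel \<Otimes>\<^sub>M borel)"
      using measurable_pair_swap[OF hm] by (simp add: split_beta')
    then show "(\<lambda>y. LINT r:{0..t - s}|lborel. h r y) \<in> borel_measurable borel"
      by (intro measurable_LINT_Icc) auto
    show "\<bar>LINT r:{0..t - s}|lborel. h r y\<bar> \<le> (t - s - 0) * B" for y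
      using s by (intro LINT_Icc_abs_le hs hb) auto
  qed
  also have "Q s (Q (t - s) f) x = Q t f x"
    using s by (subst Q_semigroup[OF f]) auto
  also have "Q s (\<lambda>y. LINT r:{0..t - s}|lborel. h r y) x = (LINT r:{0..t - s}|lborel. Q s (h r) x)"
    by (rule Q_LINT[OF hm hb])
  also have "\<dots> = (LINT r:{0..t - s}|lborel. Q (r + s) (\<lambda>y. \<phi> (v (t - (r + s)) y)) x)"
  proof (intro set_lebesgue_integral_cong allI impI)
    fix r assume r: "r \<in> {0..t - s}"
    have "Q s (h r) x = Q (s + r) (\<lambda>z. \<phi> (v (t - s - r) z)) x"
      unfolding h_def
    proof (rule Q_semigroup)
      show "(\<lambda>z. \<phi> (v (t - s - r) z)) \<in> borel_measurable borel"
        by (rule locally_bounded_field_section[OF w])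
      show "\<bar>\<phi> (v (t - s - r) y)\<bar> \<le> B" for y
        using r s by (intro B) auto
    qed (use r s in auto)
    then show "Q s (h r) x = Q (r + s) (\<lambda>y. \<phi> (v (t - (r + s)) y)) x"
      by (simp add: algebra_simps)
  qed simp
  also have "\<dots> = (LINT u:{s..t}|lborel. Q u (\<lambda>y. \<phi> (v (t - u) y)) x)"
    by (subst LINT_Icc_shift) simp
  finally show ?thesis .
qed

text \<open>
  Absorbing a decay rate: adding \<open>c\<close> times the identity to the reaction and killing the process at
  rate \<open>c\<close> cancel each other. With \<open>c\<close> a Lipschitz constant of \<open>\<phi>\<close> the new reaction is
  nondecreasing, as the comparison principle requires.
\<close>

lemma mild_solution_absorb_decay:
  assumes lip: "L-lipschitz_on UNIV \<phi>"
    and f: "f \<in> borel_measurable borel" "\<And>y. \<bar>f y\<bar> \<le> C"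
    and sol: "mild_solution \<phi> f v" and c: "0 \<le> c" and t: "0 \<le> t"
  shows "v t x = duhamel c (\<lambda>r. \<phi> r + c * r) f v t x"
proof -
  note v = mild_solutionD(1)[OF sol]
  note w = locally_bounded_field_lipschitz[OF v lip]
  define G where "G u = Q u (\<lambda>y. \<phi> (v (t - u) y)) x" for u
  have Gm[measurable]: "G \<in> borel_measurable borel"
    unfolding G_def by (rule duhamel_integrand_measurable[OF v lip])
  obtain B where B: "0 \<le> B" "\<And>r y. \<lbrakk>0 \<le> r; r \<le> t\<rbrakk> \<Longrightarrow> \<bar>\<phi> (v r y)\<bar> \<le> B"
      "\<And>u. u \<in> {0..t} \<Longrightarrow> \<bar>G u\<bar> \<le> B"
    unfolding G_def using duhamel_integrand[OF v lip, of t] by (metis atLeastAtMost_iff order_refl)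
  obtain A where A: "\<forall>s\<in>{0..t}. \<forall>y. \<bar>v s y\<bar> \<le> A"
    using locally_bounded_fieldD(2)[OF v] by blast
  let ?E = "\<lambda>s. exp (- c * s)"
  have e: "?E s \<le> 1" if "s \<in> {0..t}" for s
    using that c by simp
  have key: "Q s (\<lambda>y. \<phi> (v (t - s) y) + c * v (t - s) y) x = G s + c * (Q t f x + (LINT u:{s..t}|lborel. G u))"
    if s: "s \<in> {0..t}" for s
  proof -
    have "Q s (\<lambda>y. \<phi> (v (t - s) y) + c * v (t - s) y) x = G s + Q s (\<lambda>y. c * v (t - s) y) x"
      unfolding G_def
    proof (rule Q_add[where B = B and C = "c * A"])
      show "(\<lambda>y. \<phi> (v (t - s) y)) \<in> borel_measurable borel"
        by (rule locally_bounded_field_section[OF w])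
      show "(\<lambda>y. c * v (t - s) y) \<in> borel_measurable borel"
        using locally_bounded_field_section[OF v] by (intro borel_measurable_times) auto
      show "\<bar>\<phi> (v (t - s) y)\<bar> \<le> B" for y
        using s by (intro B) auto
      show "\<bar>c * v (t - s) y\<bar> \<le> c * A" for y
        using s A c by (auto simp: abs_mult intro!: mult_left_mono)
    qed
    also have "Q s (\<lambda>y. c * v (t - s) y) x = c * Q s (v (t - s)) x"
      by (rule Q_cmult)
    also have "Q s (v (t - s)) x = Q t f x + (LINT u:{s..t}|lborel. G u)"
      unfolding G_def using s by (intro mild_solution_propagate[OF lip f sol]) auto
    finally show ?thesis .
  qed
  have i1: "set_integrable lborel {0..t} (\<lambda>s. ?E s * G s)"
    unfolding G_def using c by (intro duhamel_set_integrable[OF v lip]) auto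
  have i2: "set_integrable lborel {0..t} (\<lambda>s. Q t f x * (c * ?E s))"
    by (intro borel_integrable_atLeastAtMost' continuous_intros)
  have i3: "set_integrable lborel {0..t} (\<lambda>s. c * ?E s * (LINT u:{s..t}|lborel. G u))"
  proof (rule set_integrable_bounded_Icc[where B = "c * (t * B)"])
    have "(\<lambda>s. LINT u:{s..t}|lborel. G u) \<in> borel_measurable borel"
      by (rule measurable_LINT_Icc) measurable
    then show "(\<lambda>s. c * ?E s * (LINT u:{s..t}|lborel. G u)) \<in> borel_measurable borel"
      by measurable
    fix s assume s: "s \<in> {0..t}"
    have "\<bar>LINT u:{s..t}|lborel. G u\<bar> \<le> (t - s) * B"
      using s by (intro LINT_Icc_abs_le B Gm) auto
    also have "\<dots> \<le> t * B"
      using s B by (intro mult_right_mono) auto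
    finally have "(c * ?E s) * \<bar>LINT u:{s..t}|lborel. G u\<bar> \<le> (c * 1) * (t * B)"
      using c e[OF s] by (intro mult_mono) (auto simp: mult_left_le)
    then show "\<bar>c * ?E s * (LINT u:{s..t}|lborel. G u)\<bar> \<le> c * (t * B)"
      using c by (simp add: abs_mult)
  qed
  have "(LINT s:{0..t}|lborel. ?E s * Q s (\<lambda>y. \<phi> (v (t - s) y) + c * v (t - s) y) x)
      = (LINT s:{0..t}|lborel. ?E s * G s
          + (Q t f x * (c * ?E s) + c * ?E s * (LINT u:{s..t}|lborel. G u)))"
    by (intro set_lebesgue_integral_cong) (auto simp: key algebra_simps)
  also have "\<dots> = (LINT s:{0..t}|lborel. ?E s * G s)
      + ((LINT s:{0..t}|lborel. Q t f x * (c * ?E s))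
        + (LINT s:{0..t}|lborel. c * ?E s * (LINT u:{s..t}|lborel. G u)))"
    by (simp only: set_integral_add(2)[OF i1 set_integral_add(1)[OF i2 i3]] set_integral_add(2)[OF i2 i3])
  also have "(LINT s:{0..t}|lborel. Q t f x * (c * ?E s)) = Q t f x * (1 - ?E t)"
    unfolding LINT_Icc_exp(1)[OF t, of c, symmetric] by (rule set_integral_mult_right)
  also have "(LINT s:{0..t}|lborel. c * ?E s * (LINT u:{s..t}|lborel. G u))
      = (LINT u:{0..t}|lborel. (1 - ?E u) * G u)"
    by (rule LINT_Icc_exp_triangle[OF t Gm B(3)])
  also have "\<dots> = (LINT u:{0..t}|lborel. G u) - (LINT u:{0..t}|lborel. ?E u * G u)"
    using set_integral_diff(2)[OF set_integrable_bounded_Icc[OF Gm B(3)] i1]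
    by (simp add: left_diff_distrib)
  finally have "duhamel c (\<lambda>r. \<phi> r + c * r) f v t x = Q t f x + (LINT u:{0..t}|lborel. G u)"
    by (simp add: duhamel_def algebra_simps)
  then show ?thesis
    using mild_solutionD(2)[OF sol t] by (simp add: G_def)
qed

lemma mild_solution_unique:
  assumes lip: "L-lipschitz_on UNIV \<phi>"
    and f: "f \<in> borel_measurable borel" "\<And>y. \<bar>f y\<bar> \<le> C"
    and sol: "mild_solution \<phi> f v" "mild_solution \<phi> f w" and t: "0 \<le> t"
  shows "v t x = w t x"
proof -
  note L = lipschitz_on_nonneg[OF lip]
  note eqs = mild_solution_absorb_decay[OF lip f sol(1) L] mild_solution_absorb_decay[OF lip f sol(2) L]
  show ?thesis
    using eqs
    by (intro antisym duhamel_comparison[OF sol[THEN mild_solutionD(1)] lipschitz_add_linear[OF lip] L _ _ t, where f = f]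
        duhamel_comparison[OF sol(2,1)[THEN mild_solutionD(1)] lipschitz_add_linear[OF lip] L _ _ t, where f = f])
      simp_all
qed

text \<open>
  Cut the time integral up to \<open>s + t\<close> at \<open>t\<close>: the late part is what \<open>Q\<^sub>t\<close> makes of the integral
  in the formula for \<open>v s\<close>.
\<close>

lemma mild_solution_restart:
  assumes lip: "L-lipschitz_on UNIV \<phi>"
    and f: "f \<in> borel_measurable borel" "\<And>y. \<bar>f y\<bar> \<le> C"
    and sol: "mild_solution \<phi> f v" and s: "0 \<le> s"
  shows "mild_solution \<phi> (v s) (\<lambda>t. v (s + t))"
  unfolding mild_solution_def
proof (intro conjI allI impI)
  note v = mild_solutionD(1)[OF sol]
  show "locally_bounded_field (\<lambda>t. v (s + t))"
    unfolding locally_bounded_field_def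
  proof (intro conjI allI)
    show "(\<lambda>(t, x). v (s + t) x) \<in> borel_measurable (borel \<Otimes>\<^sub>M borel)"
      unfolding split_beta' by (rule locally_bounded_field_measurable_compose[OF v]) measurable
    fix T
    obtain B where "\<forall>t\<in>{0..s + T}. \<forall>x. \<bar>v t x\<bar> \<le> B"
      using locally_bounded_fieldD(2)[OF v] by blast
    then show "\<exists>B. \<forall>t\<in>{0..T}. \<forall>x. \<bar>v (s + t) x\<bar> \<le> B"
      using s by (intro exI[of _ B]) auto
  qed
  fix t :: real and x assume t: "0 \<le> t"
  define G where "G u = Q u (\<lambda>y. \<phi> (v (s + t - u) y)) x" for u
  have int: "set_integrable lborel {0..s + t} G"
    unfolding G_def using duhamel_set_integrable[OF v lip, of 0 0 "s + t" "s + t"] by simp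
  have "v (s + t) x = Q (s + t) f x + (LINT u:{0..s + t}|lborel. G u)"
    unfolding G_def using s t by (intro mild_solutionD(2)[OF sol]) auto
  also have "\<dots> = (Q (s + t) f x + (LINT u:{t..s + t}|lborel. G u)) + (LINT u:{0..t}|lborel. G u)"
    using s t by (subst LINT_Icc_split[OF _ _ int, of t]) auto
  also have "Q (s + t) f x + (LINT u:{t..s + t}|lborel. G u) = Q t (v (s + t - t)) x"
    unfolding G_def using s t by (intro mild_solution_propagate[OF lip f sol, symmetric]) auto
  finally show "v (s + t) x = duhamel 0 \<phi> (v s) (\<lambda>t. v (s + t)) t x"
    by (simp add: duhamel_def G_def add_diff_eq)
qed

end

section \<open>The reaction flow\<close>

lemma markov_kernels_return: "markov_kernels (\<lambda>_. return (borel :: 'a::topological_space measure))"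
proof (rule markov_kernels.intro)
  fix t x
  show "prob_space (return (borel :: 'a measure) x)"
    by (rule prob_space_return) simp
next
  show "(\<lambda>(t :: real, x). return borel x) \<in> borel \<Otimes>\<^sub>M (borel :: 'a measure) \<rightarrow>\<^sub>M subprob_algebra borel"
    unfolding split_beta' by (rule measurable_compose[OF measurable_snd return_measurable])
next
  fix s t :: real and x :: 'a
  show "return borel x = return borel x \<bind> return borel"
    by (rule bind_return[OF return_measurable, symmetric]) simp
qed

lemma (in markov_kernels) mild_solution_of_ode:
  assumes lip: "L-lipschitz_on UNIV \<phi>" and ode: "ode_solution \<phi> r0 r"
  shows "mild_solution \<phi> (\<lambda>_. r0) (\<lambda>t x. r (max 0 t))"
  unfolding mild_solution_def
proof (intro conjI allI impI)
  have deriv: "(r has_real_derivative \<phi> (r t)) (at t within {0..})" if "0 \<le> t" for t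
    using ode that by (simp add: ode_solution_def)
  have "continuous_on {0..} r"
    unfolding continuous_on_eq_continuous_within
    using deriv by (auto intro: DERIV_continuous)
  then have cont: "continuous_on UNIV (\<lambda>t. r (max 0 t))"
    by (rule continuous_on_compose2) (auto intro!: continuous_intros)
  show "locally_bounded_field (\<lambda>t (x :: 'a). r (max 0 t))"
    unfolding locally_bounded_field_def
  proof (intro conjI allI)
    show "(\<lambda>(t, x). r (max 0 t)) \<in> borel_measurable (borel \<Otimes>\<^sub>M (borel :: 'a measure))"
      unfolding split_beta'
      by (rule measurable_compose[OF measurable_fst borel_measurable_continuous_onI[OF cont]])
    fix T :: real
    have "compact ((\<lambda>t. r (max 0 t)) ` {0..T})"
      by (intro compact_continuous_image continuous_on_subset[OF cont]) auto
    then have "bounded ((\<lambda>t. r (max 0 t)) ` {0..T})"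
      by (rule compact_imp_bounded)
    then show "\<exists>B. \<forall>t\<in>{0..T}. \<forall>x :: 'a. \<bar>r (max 0 t)\<bar> \<le> B"
      by (auto simp: bounded_iff)
  qed
  fix t :: real and x :: 'a assume t: "0 \<le> t"
  have "(LINT s:{0..t}|lborel. \<phi> (r (max 0 (t - s)))) = (LINT s:{0..t}|lborel. \<phi> (r (max 0 s)))"
    by (rule LINT_Icc_reflect)
  also have "\<dots> = (\<integral>s. indicator {0..t} s *\<^sub>R \<phi> (r (max 0 s)) \<partial>lborel)"
    by (simp add: set_lebesgue_integral_def)
  also have "\<dots> = r t - r 0"
  proof (rule integral_FTC_Icc[OF t])
    show "continuous_on {0..t} (\<lambda>s. \<phi> (r (max 0 s)))"
      using lipschitz_on_continuous_on[OF lip] cont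
      by (intro continuous_on_compose2[of UNIV \<phi> _ "\<lambda>s. r (max 0 s)"]) (auto intro: continuous_on_subset)
    show "(r has_vector_derivative \<phi> (r (max 0 s))) (at s within {0..t})" if "0 \<le> s" "s \<le> t" for s
      using DERIV_subset[OF deriv[OF that(1)], of "{0..t}"] that
      by (auto simp: has_real_derivative_iff_has_vector_derivative)
  qed
  also have "r 0 = r0"
    using ode by (simp add: ode_solution_def)
  finally show "r (max 0 t) = duhamel 0 \<phi> (\<lambda>_. r0) (\<lambda>t x. r (max 0 t)) t x"
    using t by (simp add: duhamel_def Q_const)
qed

lemma concave_on_UNIV_realD:
  fixes \<rho> :: "real \<Rightarrow> real"
  assumes "concave_on UNIV \<rho>" "0 \<le> p" "0 \<le> q" "p + q = 1"
  shows "p * \<rho> a + q * \<rho> b \<le> \<rho> (p * a + q * b)"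
proof -
  have "p = 1 - q"
    using assms(4) by simp
  then show ?thesis
    using concave_onD[OF assms(1), of q a b] assms(2,3) by simp
qed

lemma concave_add_linear:
  fixes \<phi> :: "real \<Rightarrow> real"
  assumes "concave_on UNIV \<phi>"
  shows "concave_on UNIV (\<lambda>r. \<phi> r + L * r)"
  unfolding concave_on_iff
proof (intro conjI ballI allI impI)
  fix a b p q :: real assume pq: "0 \<le> p" "0 \<le> q" "p + q = 1"
  show "p * (\<phi> a + L * a) + q * (\<phi> b + L * b) \<le> \<phi> (p *\<^sub>R a + q *\<^sub>R b) + L * (p *\<^sub>R a + q *\<^sub>R b)"
    using concave_on_UNIV_realD[OF assms pq, of a b] by (simp add: algebra_simps)
qed auto

context
  fixes \<phi> :: "real \<Rightarrow> real" and L :: real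
  assumes lip: "L-lipschitz_on UNIV \<phi>"
begin

text \<open>
  For a process that never moves, Duhamel's formula is the integrated ordinary differential equation,
  separately at every point. Hence the theory of mild solutions provides the reaction flow together
  with its measurability and local boundedness.
\<close>

lemma motionless_mild_solution:
  fixes f :: "'a::topological_space \<Rightarrow> real"
  assumes f: "f \<in> borel_measurable borel" "\<And>y. \<bar>f y\<bar> \<le> C"
  obtains v where "locally_bounded_field v" "\<And>x. ode_solution \<phi> (f x) (\<lambda>t. v t x)"
proof -
  interpret M: markov_kernels "\<lambda>_. return (borel :: 'a measure)"
    by (rule markov_kernels_return)
  obtain v where sol: "M.mild_solution \<phi> f v"
    using M.mild_solution_exists[OF lip f] by blast
  note v = M.mild_solutionD(1)[OF sol]
  note w = locally_bounded_field_lipschitz[OF v lip]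
  have "ode_solution \<phi> (f x) (\<lambda>t. v t x)" for x
  proof -
    define r where "r t = v t x" for t
    have [measurable]: "(\<lambda>s. \<phi> (v s x)) \<in> borel_measurable borel"
      by (rule locally_bounded_field_measurable_compose[OF w]) auto
    have bnd: "\<exists>B\<ge>0. \<forall>s\<in>{0..T}. \<bar>\<phi> (v s x)\<bar> \<le> B" for T
      using locally_bounded_fieldD(2)[OF w, of T] by blast
    have int: "set_integrable lborel {0..T} (\<lambda>s. \<phi> (r s))" for T
    proof -
      obtain B where "\<forall>s\<in>{0..T}. \<bar>\<phi> (v s x)\<bar> \<le> B"
        using bnd by blast
      then show ?thesis
        by (intro set_integrable_bounded_Icc[where B = B]) (auto simp: r_def)
    qed
    have r: "r t = f x + integral {0..t} (\<lambda>s. \<phi> (r s))" if t: "0 \<le> t" for t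
    proof -
      have "r t = f x + (LINT s:{0..t}|lborel. \<phi> (v (t - s) x))"
        unfolding r_def
        by (subst M.mild_solutionD(2)[OF sol t])
           (simp add: M.Q_def integral_return f locally_bounded_field_section[OF w])
      also have "(LINT s:{0..t}|lborel. \<phi> (v (t - s) x)) = (LINT s:{0..t}|lborel. \<phi> (r s))"
        unfolding r_def by (rule LINT_Icc_reflect)
      finally show ?thesis
        using set_borel_integral_eq_integral(2)[OF int] by simp
    qed
    have "(r has_real_derivative \<phi> (r t)) (at t within {0..})" if t: "0 \<le> t" for t
    proof -
      let ?I = "{0..t + 1}"
      have "(\<lambda>s. \<phi> (r s)) integrable_on ?I"
        by (rule set_borel_integral_eq_integral(1)[OF int])
      then have "continuous_on ?I (\<lambda>t. f x + integral {0..t} (\<lambda>s. \<phi> (r s)))"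
        by (intro continuous_intros indefinite_integral_continuous_1)
      then have "continuous_on ?I r"
        by (rule continuous_on_eq) (use r in force)
      then have "continuous_on ?I (\<lambda>s. \<phi> (r s))"
        by (rule continuous_on_compose2[OF lipschitz_on_continuous_on[OF lip]]) simp
      then have "((\<lambda>t. integral {0..t} (\<lambda>s. \<phi> (r s))) has_real_derivative \<phi> (r t)) (at t within ?I)"
        using t by (intro integral_has_real_derivative) auto
      then have "((\<lambda>t. f x + integral {0..t} (\<lambda>s. \<phi> (r s))) has_real_derivative \<phi> (r t)) (at t within ?I)"
        by (auto intro!: derivative_eq_intros)
      then have "(r has_real_derivative \<phi> (r t)) (at t within ?I)"
        by (rule has_field_derivative_transform_within[where d = 1]) (use t r in auto)
      also have "at t within ?I = at t within {0..}"
        by (rule at_within_nhd[of t "{..<t + 1}"]) (use t in auto)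
      finally show ?thesis .
    qed
    moreover have "r 0 = f x"
      using r[of 0] by simp
    moreover have "(\<lambda>t. v t x) = r"
      by (simp add: r_def fun_eq_iff)
    ultimately show ?thesis
      by (simp add: ode_solution_def)
  qed
  with v show ?thesis
    by (rule that)
qed

lemma ode_flow_eq:
  assumes r: "ode_solution \<phi> r0 r" and t: "0 \<le> t"
  shows "ode_flow \<phi> t r0 = r t"
  unfolding ode_flow_def
proof (rule the_equality)
  interpret M: markov_kernels "\<lambda>_. return (borel :: real measure)"
    by (rule markov_kernels_return)
  show "\<exists>r'. ode_solution \<phi> r0 r' \<and> r t = r' t"
    using r by blast
  fix y assume "\<exists>r'. ode_solution \<phi> r0 r' \<and> y = r' t"
  then obtain r' where r': "ode_solution \<phi> r0 r'" "y = r' t"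
    by blast
  show "y = r t"
    using M.mild_solution_unique[OF lip _ _ M.mild_solution_of_ode[OF lip r'(1)]
        M.mild_solution_of_ode[OF lip r] t, of "\<bar>r0\<bar>"] r'(2) t
    by simp
qed

lemma ode_flow_solution: "ode_solution \<phi> r0 (\<lambda>t. ode_flow \<phi> (max 0 t) r0)"
proof -
  obtain v :: "real \<Rightarrow> real \<Rightarrow> real" where v: "\<And>x. ode_solution \<phi> r0 (\<lambda>t. v t x)"
    by (rule motionless_mild_solution[of "\<lambda>_ :: real. r0" "\<bar>r0\<bar>"]) auto
  have eq: "ode_flow \<phi> t r0 = v t 0" if "0 \<le> t" for t
    by (rule ode_flow_eq[OF v that])
  have "((\<lambda>t. ode_flow \<phi> (max 0 t) r0) has_real_derivative \<phi> (ode_flow \<phi> (max 0 t) r0))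
      (at t within {0..})" if t: "0 \<le> t" for t
  proof -
    have "((\<lambda>t. v t 0) has_real_derivative \<phi> (v t 0)) (at t within {0..})"
      using v t by (auto simp: ode_solution_def)
    then have "((\<lambda>t. ode_flow \<phi> (max 0 t) r0) has_real_derivative \<phi> (v t 0)) (at t within {0..})"
      by (rule has_field_derivative_transform_within[where d = 1]) (use t eq in auto)
    then show ?thesis
      using t by (simp add: eq)
  qed
  moreover have "ode_flow \<phi> (max 0 0) r0 = r0"
    using v[of 0] by (simp add: eq ode_solution_def)
  ultimately show ?thesis
    by (simp add: ode_solution_def)
qed

text \<open>
  An initial value may vary with both time and space here, as it does in \<open>R\<^sub>t (Q\<^sub>t f)\<close>; this needs the
  flow to be jointly measurable in time and initial value.
\<close>

lemma ode_flow_field: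
  fixes g :: "real \<Rightarrow> 'a::topological_space \<Rightarrow> real"
  assumes g: "(\<lambda>(t, x). g t x) \<in> borel_measurable (borel \<Otimes>\<^sub>M borel)" and bnd: "\<And>t x. \<bar>g t x\<bar> \<le> C"
  shows "locally_bounded_field (\<lambda>t x. ode_flow \<phi> (max 0 t) (g t x))"
proof -
  have C: "0 \<le> C"
    using bnd[of 0 undefined] by linarith
  \<comment> \<open>clamping makes the identity a bounded initial value and does not change the values of \<open>g\<close>\<close>
  obtain v :: "real \<Rightarrow> real \<Rightarrow> real" where v: "locally_bounded_field v"
    and ode: "\<And>r. ode_solution \<phi> (max (- C) (min C r)) (\<lambda>t. v t r)"
  proof (rule motionless_mild_solution[of "\<lambda>r. max (- C) (min C r)" C])
    show "\<bar>max (- C) (min C r)\<bar> \<le> C" for r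
      using C by linarith
  qed auto
  have eq: "ode_flow \<phi> (max 0 t) (g t x) = v (max 0 t) (g t x)" for t x
  proof -
    have "max (- C) (min C (g t x)) = g t x"
      using bnd[of t x] by (auto simp: abs_le_iff)
    then show ?thesis
      using ode_flow_eq[OF ode[of "g t x"], of "max 0 t"] by simp
  qed
  show ?thesis
    unfolding locally_bounded_field_def eq
  proof (intro conjI allI)
    have [measurable]: "(\<lambda>p. g (fst p) (snd p)) \<in> borel_measurable (borel \<Otimes>\<^sub>M borel)"
      using g by (simp add: split_beta')
    show "(\<lambda>(t, x). v (max 0 t) (g t x)) \<in> borel_measurable (borel \<Otimes>\<^sub>M borel)"
      unfolding split_beta' by (rule locally_bounded_field_measurable_compose[OF v]) measurable
    fix T
    obtain B where "\<forall>t\<in>{0..T}. \<forall>x. \<bar>v t x\<bar> \<le> B"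
      using locally_bounded_fieldD(2)[OF v] by blast
    then show "\<exists>B. \<forall>t\<in>{0..T}. \<forall>x. \<bar>v (max 0 t) (g t x)\<bar> \<le> B"
      by auto
  qed
qed

text \<open>
  Sub- and supersolutions can be compared with the flow in this form, because its reaction
  \<open>\<phi> r + L r\<close> is nondecreasing.
\<close>

lemma ode_flow_duhamel:
  assumes t: "0 \<le> t"
  shows "ode_flow \<phi> t r = exp (- L * t) * r
      + (LINT s:{0..t}|lborel. exp (- L * s) * (\<phi> (ode_flow \<phi> (t - s) r) + L * ode_flow \<phi> (t - s) r))"
    and "set_integrable lborel {0..t}
      (\<lambda>s. exp (- L * s) * (\<phi> (ode_flow \<phi> (t - s) r) + L * ode_flow \<phi> (t - s) r))"
proof -
  let ?h = "\<lambda>s. exp (- L * s) * (\<phi> (ode_flow \<phi> (t - s) r) + L * ode_flow \<phi> (t - s) r)"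
  interpret M: markov_kernels "\<lambda>_. return (borel :: real measure)"
    by (rule markov_kernels_return)
  have sol: "M.mild_solution \<phi> (\<lambda>_. r) (\<lambda>t x. ode_flow \<phi> (max 0 t) r)"
    using M.mild_solution_of_ode[OF lip ode_flow_solution[of r]] by simp
  note L = lipschitz_on_nonneg[OF lip]
  have "set_integrable lborel {0..t}
      (\<lambda>s. exp (- L * s) * (\<phi> (ode_flow \<phi> (max 0 (t - s)) r) + L * ode_flow \<phi> (max 0 (t - s)) r))"
    using M.duhamel_set_integrable[OF M.mild_solutionD(1)[OF sol] lipschitz_add_linear(1)[OF lip]
        L order_refl order_refl[of t]] by (simp add: M.Q_const)
  then show "set_integrable lborel {0..t} ?h"
    by (rule set_integrable_cong[THEN iffD1, rotated -1]) auto
  have "ode_flow \<phi> t r = exp (- L * t) * r + (LINT s:{0..t}|lborel.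
      exp (- L * s) * (\<phi> (ode_flow \<phi> (max 0 (t - s)) r) + L * ode_flow \<phi> (max 0 (t - s)) r))"
    using M.mild_solution_absorb_decay[OF lip _ _ sol L t, of "\<bar>r\<bar>"] t
    by (simp add: M.duhamel_def M.Q_const)
  also have "(LINT s:{0..t}|lborel.
      exp (- L * s) * (\<phi> (ode_flow \<phi> (max 0 (t - s)) r) + L * ode_flow \<phi> (max 0 (t - s)) r))
      = (LINT s:{0..t}|lborel. ?h s)"
    by (intro set_lebesgue_integral_cong) auto
  finally show "ode_flow \<phi> t r = exp (- L * t) * r + (LINT s:{0..t}|lborel. ?h s)" .
qed

lemma ode_flow_le_subsolution:
  fixes m :: "real \<Rightarrow> real"
  assumes m: "locally_bounded_field (\<lambda>t (_ :: real). m t)"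
    and sub: "\<And>t. 0 \<le> t \<Longrightarrow> m t \<le> exp (- L * t) * r
      + (LINT s:{0..t}|lborel. exp (- L * s) * (\<phi> (m (t - s)) + L * m (t - s)))"
    and t: "0 \<le> t"
  shows "m t \<le> ode_flow \<phi> t r"
proof -
  interpret M: markov_kernels "\<lambda>_. return (borel :: real measure)"
    by (rule markov_kernels_return)
  have sol: "M.mild_solution \<phi> (\<lambda>_. r) (\<lambda>t x. ode_flow \<phi> (max 0 t) r)"
    using M.mild_solution_of_ode[OF lip ode_flow_solution[of r]] by simp
  note L = lipschitz_on_nonneg[OF lip]
  have "m t \<le> ode_flow \<phi> (max 0 t) r"
  proof (rule M.duhamel_comparison[OF m M.mild_solutionD(1)[OF sol] lipschitz_add_linear[OF lip] L,
        where f = "\<lambda>_. r"])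
    show "m t \<le> M.duhamel L (\<lambda>r. \<phi> r + L * r) (\<lambda>_. r) (\<lambda>t _. m t) t x" if "0 \<le> t" for t x
      using sub[OF that] by (simp add: M.duhamel_def M.Q_const)
    show "M.duhamel L (\<lambda>r. \<phi> r + L * r) (\<lambda>_. r) (\<lambda>t _. ode_flow \<phi> (max 0 t) r) t x
        \<le> ode_flow \<phi> (max 0 t) r" if "0 \<le> t" for t x
      using M.mild_solution_absorb_decay[OF lip _ _ sol L that, of "\<bar>r\<bar>"] by simp
  qed (rule t)
  with t show ?thesis
    by simp
qed

lemma ode_flow_const_field: "locally_bounded_field (\<lambda>t (_ :: real). ode_flow \<phi> (max 0 t) r)"
  by (rule ode_flow_field[where C = "\<bar>r\<bar>"]) auto

lemma mono_ode_flow: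
  assumes t: "0 \<le> t"
  shows "mono (ode_flow \<phi> t)"
proof (rule monoI)
  fix a b :: real assume "a \<le> b"
  have "ode_flow \<phi> (max 0 t) a \<le> ode_flow \<phi> t b"
  proof (rule ode_flow_le_subsolution[OF ode_flow_const_field _ t])
    fix t :: real assume t: "0 \<le> t"
    have "ode_flow \<phi> t a = exp (- L * t) * a
      + (LINT s:{0..t}|lborel. exp (- L * s) * (\<phi> (ode_flow \<phi> (max 0 (t - s)) a) + L * ode_flow \<phi> (max 0 (t - s)) a))"
      by (subst ode_flow_duhamel(1)[OF t]) (auto intro!: set_lebesgue_integral_cong)
    moreover have "exp (- L * t) * a \<le> exp (- L * t) * b"
      using \<open>a \<le> b\<close> by simp
    ultimately show "ode_flow \<phi> (max 0 t) a \<le> exp (- L * t) * b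
      + (LINT s:{0..t}|lborel. exp (- L * s) * (\<phi> (ode_flow \<phi> (max 0 (t - s)) a) + L * ode_flow \<phi> (max 0 (t - s)) a))"
      using t by simp
  qed
  with t show "ode_flow \<phi> t a \<le> ode_flow \<phi> t b"
    by simp
qed

text \<open>
  A convex combination of two orbits is a subsolution, because the reaction is concave; so it stays
  below the orbit of the convex combination of the initial values.
\<close>

lemma concave_ode_flow:
  assumes conc: "concave_on UNIV \<phi>" and t: "0 \<le> t"
  shows "concave_on UNIV (ode_flow \<phi> t)"
  unfolding concave_on_iff
proof (intro conjI ballI allI impI)
  fix a b p q :: real assume pq: "0 \<le> p" "0 \<le> q" "p + q = 1"
  let ?m = "\<lambda>t. p * ode_flow \<phi> t a + q * ode_flow \<phi> t b"
  let ?\<psi> = "\<lambda>r. \<phi> r + L * r"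
  have m: "locally_bounded_field (\<lambda>t (_ :: real). ?m (max 0 t))"
    unfolding locally_bounded_field_def
  proof (intro conjI allI)
    show "(\<lambda>(t, _). ?m (max 0 t)) \<in> borel_measurable (borel \<Otimes>\<^sub>M (borel :: real measure))"
      unfolding split_beta'
      using locally_bounded_fieldD(1)[OF ode_flow_const_field, of a]
        locally_bounded_fieldD(1)[OF ode_flow_const_field, of b]
      by (intro borel_measurable_add borel_measurable_times borel_measurable_const) (auto simp: split_beta')
    fix T :: real
    obtain A where A: "\<forall>t\<in>{0..T}. \<forall>x :: real. \<bar>ode_flow \<phi> (max 0 t) a\<bar> \<le> A"
      using locally_bounded_fieldD(2)[OF ode_flow_const_field] by blast
    obtain B where B: "\<forall>t\<in>{0..T}. \<forall>x :: real. \<bar>ode_flow \<phi> (max 0 t) b\<bar> \<le> B"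
      using locally_bounded_fieldD(2)[OF ode_flow_const_field] by blast
    have "\<bar>?m (max 0 t)\<bar> \<le> p * A + q * B" if "t \<in> {0..T}" for t
    proof -
      have "p * \<bar>ode_flow \<phi> (max 0 t) a\<bar> \<le> p * A" "q * \<bar>ode_flow \<phi> (max 0 t) b\<bar> \<le> q * B"
        using A B that pq by (auto intro: mult_left_mono)
      moreover have "\<bar>?m (max 0 t)\<bar> \<le> p * \<bar>ode_flow \<phi> (max 0 t) a\<bar> + q * \<bar>ode_flow \<phi> (max 0 t) b\<bar>"
        using pq by (intro abs_triangle_ineq[THEN order_trans]) (simp add: abs_mult)
      ultimately show ?thesis
        by linarith
    qed
    then show "\<exists>B. \<forall>t\<in>{0..T}. \<forall>x :: real. \<bar>?m (max 0 t)\<bar> \<le> B"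
      by blast
  qed
  have "?m (max 0 t) \<le> ode_flow \<phi> t (p * a + q * b)"
  proof (rule ode_flow_le_subsolution[OF m _ t])
    fix t :: real assume t: "0 \<le> t"
    let ?h = "\<lambda>r s. exp (- L * s) * ?\<psi> (ode_flow \<phi> (t - s) r)"
    note int = ode_flow_duhamel(2)[OF t]
    have int': "set_integrable lborel {0..t} (\<lambda>s. p * ?h a s + q * ?h b s)"
      by (intro set_integral_add(1) set_integrable_mult_right int)
    interpret M: markov_kernels "\<lambda>_. return (borel :: real measure)"
      by (rule markov_kernels_return)
    have int_m: "set_integrable lborel {0..t} (\<lambda>s. exp (- L * s) * ?\<psi> (?m (max 0 (t - s))))"
      using M.duhamel_set_integrable[OF m lipschitz_add_linear(1)[OF lip] lipschitz_on_nonneg[OF lip]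
          order_refl order_refl[of t]] by (simp add: M.Q_const)
    have m_eq: "?m t = exp (- L * t) * (p * a + q * b)
        + (p * (LINT s:{0..t}|lborel. ?h a s) + q * (LINT s:{0..t}|lborel. ?h b s))"
      by (subst (1 2) ode_flow_duhamel(1)[OF t]) (simp add: algebra_simps)
    have LINT_eq: "p * (LINT s:{0..t}|lborel. ?h a s) + q * (LINT s:{0..t}|lborel. ?h b s)
        = (LINT s:{0..t}|lborel. p * ?h a s + q * ?h b s)"
      using set_integral_add(2)[OF set_integrable_mult_right[of p, OF int] set_integrable_mult_right[of q, OF int], of a b]
      by simp
    have "(LINT s:{0..t}|lborel. p * ?h a s + q * ?h b s)
        \<le> (LINT s:{0..t}|lborel. exp (- L * s) * ?\<psi> (?m (max 0 (t - s))))"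
    proof (rule set_integral_mono[OF int' int_m])
      fix s assume "s \<in> {0..t}"
      then have eq: "max 0 (t - s) = t - s"
        by simp
      have "p * ?h a s + q * ?h b s
          = exp (- L * s) * (p * ?\<psi> (ode_flow \<phi> (t - s) a) + q * ?\<psi> (ode_flow \<phi> (t - s) b))"
        by (simp only: distrib_left mult.left_commute)
      also have "\<dots> \<le> exp (- L * s) * ?\<psi> (?m (t - s))"
        by (intro mult_left_mono concave_on_UNIV_realD[OF concave_add_linear[OF conc] pq]) simp
      finally show "p * ?h a s + q * ?h b s \<le> exp (- L * s) * ?\<psi> (?m (max 0 (t - s)))"
        by (simp only: eq)
    qed
    then show "?m (max 0 t) \<le> exp (- L * t) * (p * a + q * b)
        + (LINT s:{0..t}|lborel. exp (- L * s) * ?\<psi> (?m (max 0 (t - s))))"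
      unfolding max_absorb2[OF t] m_eq LINT_eq by (rule add_left_mono)
  qed
  then show "p * ode_flow \<phi> t a + q * ode_flow \<phi> t b \<le> ode_flow \<phi> t (p *\<^sub>R a + q *\<^sub>R b)"
    unfolding max_absorb2[OF t] real_scaleR_def .
qed auto

end

section \<open>Splitting\<close>

context markov_kernels
begin

lemma Q_jensen:
  assumes \<rho>: "concave_on UNIV \<rho>"
    and g: "g \<in> borel_measurable borel" "\<And>y. \<bar>g y\<bar> \<le> B"
    and \<rho>g: "(\<lambda>y. \<rho> (g y)) \<in> borel_measurable borel" "\<And>y. \<bar>\<rho> (g y)\<bar> \<le> C"
  shows "Q t (\<lambda>y. \<rho> (g y)) x \<le> \<rho> (Q t g x)"
proof -
  interpret prob_space "K t x"
    by (rule prob_space_K)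
  have "- \<rho> (expectation g) \<le> expectation (\<lambda>y. - \<rho> (g y))"
  proof (rule jensens_inequality[where I = UNIV])
    show "integrable (K t x) g"
      by (rule integrable_K[OF g])
    show "integrable (K t x) (\<lambda>y. - \<rho> (g y))"
      by (rule Bochner_Integration.integrable_minus[OF integrable_K[OF \<rho>g]])
    show "convex_on UNIV (\<lambda>r. - \<rho> r)"
      using \<rho> by (simp add: concave_on_def)
  qed auto
  then show ?thesis
    by (simp add: Q_def)
qed

text \<open>
  Apply the reaction flow to \<open>Q\<^sub>t f\<close>: in Duhamel's formula the reaction then acts after the whole
  diffusion, and moving it in front of \<open>Q\<^sub>s\<close> can only decrease it, by Jensen's inequality for the
  concave map \<open>\<psi> \<circ> R\<^sub>t\<^sub>-\<^sub>s\<close>. So this field is a supersolution.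
\<close>

lemma mild_solution_le_reaction_after_diffusion:
  assumes lip: "L-lipschitz_on UNIV \<phi>" and conc: "concave_on UNIV \<phi>"
    and f: "f \<in> borel_measurable borel" "\<And>y. \<bar>f y\<bar> \<le> C"
    and sol: "mild_solution \<phi> f v" and t: "0 \<le> t"
  shows "v t x \<le> ode_flow \<phi> t (Q t f x)"
proof -
  note L = lipschitz_on_nonneg[OF lip]
  note \<psi> = lipschitz_add_linear[OF lip]
  let ?\<psi> = "\<lambda>r. \<phi> r + L * r"
  define w where "w t x = ode_flow \<phi> (max 0 t) (Q t f x)" for t x
  have w: "locally_bounded_field w"
    unfolding w_def
  proof (rule ode_flow_field[OF lip])
    show "(\<lambda>(t, x). Q t f x) \<in> borel_measurable (borel \<Otimes>\<^sub>M borel)"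
      unfolding split_beta' using f by (intro measurable_Q[where h = "\<lambda>_. f"]) auto
    show "\<bar>Q t f x\<bar> \<le> C" for t x
      by (rule Q_abs_le[OF f])
  qed
  note \<psi>w = locally_bounded_field_lipschitz[OF w \<psi>(1)]
  have "v t x \<le> w t x"
  proof (rule duhamel_comparison[OF mild_solutionD(1)[OF sol] w \<psi> L _ _ t, where f = f])
    show "v t x \<le> duhamel L ?\<psi> f v t x" if "0 \<le> t" for t x
      using mild_solution_absorb_decay[OF lip f sol L that] by simp
    fix t :: real and x :: 'a assume t: "0 \<le> t"
    let ?r = "Q t f x"
    have "(LINT s:{0..t}|lborel. exp (- L * s) * Q s (\<lambda>y. ?\<psi> (w (t - s) y)) x)
        \<le> (LINT s:{0..t}|lborel. exp (- L * s) * ?\<psi> (ode_flow \<phi> (t - s) ?r))"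
    proof (rule set_integral_mono[OF duhamel_set_integrable[OF w \<psi>(1) L order_refl order_refl]
          ode_flow_duhamel(2)[OF lip t]])
      fix s assume s: "s \<in> {0..t}"
      let ?\<rho> = "\<lambda>r. ?\<psi> (ode_flow \<phi> (t - s) r)"
      obtain B where B: "\<forall>r\<in>{0..t}. \<forall>y. \<bar>?\<psi> (w r y)\<bar> \<le> B"
        using locally_bounded_fieldD(2)[OF \<psi>w] by blast
      have eq: "?\<psi> (w (t - s) y) = ?\<rho> (Q (t - s) f y)" for y
        using s by (simp add: w_def)
      have \<rho>: "concave_on UNIV ?\<rho>"
        unfolding concave_on_iff
      proof (intro conjI ballI allI impI)
        fix a b p q :: real assume pq: "0 \<le> p" "0 \<le> q" "p + q = 1"
        have "p * ?\<rho> a + q * ?\<rho> b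
            \<le> ?\<psi> (p * ode_flow \<phi> (t - s) a + q * ode_flow \<phi> (t - s) b)"
          by (rule concave_on_UNIV_realD[OF concave_add_linear[OF conc] pq])
        also have "\<dots> \<le> ?\<psi> (ode_flow \<phi> (t - s) (p * a + q * b))"
          using s by (intro monoD[OF \<psi>(2)] concave_on_UNIV_realD[OF concave_ode_flow[OF lip conc] pq]) auto
        also have "p * a + q * b = p *\<^sub>R a + q *\<^sub>R b"
          by simp
        finally show "p * ?\<rho> a + q * ?\<rho> b \<le> ?\<rho> (p *\<^sub>R a + q *\<^sub>R b)" .
      qed auto
      have "Q s (\<lambda>y. ?\<rho> (Q (t - s) f y)) x \<le> ?\<rho> (Q s (Q (t - s) f) x)"
      proof (rule Q_jensen[OF \<rho> measurable_Q_fixed[OF f(1)] Q_abs_le[OF f]])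
        show "(\<lambda>y. ?\<rho> (Q (t - s) f y)) \<in> borel_measurable borel"
          using locally_bounded_field_section[OF \<psi>w, of "t - s"] by (simp add: eq)
        show "\<bar>?\<rho> (Q (t - s) f y)\<bar> \<le> B" for y
          using B s unfolding eq[symmetric] by auto
      qed
      also have "Q s (Q (t - s) f) x = ?r"
        using s by (subst Q_semigroup[OF f]) auto
      finally show "exp (- L * s) * Q s (\<lambda>y. ?\<psi> (w (t - s) y)) x \<le> exp (- L * s) * ?\<rho> ?r"
        by (intro mult_left_mono) (simp_all add: eq)
    qed
    then have "duhamel L ?\<psi> f w t x \<le> exp (- L * t) * ?r
        + (LINT s:{0..t}|lborel. exp (- L * s) * ?\<psi> (ode_flow \<phi> (t - s) ?r))"
      by (simp add: duhamel_def)
    also have "\<dots> = ode_flow \<phi> t ?r"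
      by (rule ode_flow_duhamel(1)[OF lip t, symmetric])
    finally show "duhamel L ?\<psi> f w t x \<le> w t x"
      using t by (simp add: w_def)
  qed
  with t show ?thesis
    by (simp add: w_def)
qed

text \<open>
  Dually, \<open>Q\<^sub>t R\<^sub>t f\<close> is a subsolution: integrating Duhamel's formula for the flow against the kernel,
  one finds \<open>\<psi>\<close> under \<open>Q\<^sub>t = Q\<^sub>s Q\<^sub>t\<^sub>-\<^sub>s\<close>, and Jensen's inequality moves it out of \<open>Q\<^sub>t\<^sub>-\<^sub>s\<close>.
\<close>

lemma diffusion_after_reaction_le_mild_solution:
  assumes lip: "L-lipschitz_on UNIV \<phi>" and conc: "concave_on UNIV \<phi>"
    and f: "f \<in> borel_measurable borel" "\<And>y. \<bar>f y\<bar> \<le> C"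
    and sol: "mild_solution \<phi> f v" and t: "0 \<le> t"
  shows "Q t (\<lambda>y. ode_flow \<phi> t (f y)) x \<le> v t x"
proof -
  note L = lipschitz_on_nonneg[OF lip]
  note \<psi> = lipschitz_add_linear[OF lip]
  let ?\<psi> = "\<lambda>r. \<phi> r + L * r"
  define R where "R t y = ode_flow \<phi> (max 0 t) (f y)" for t y
  have R: "locally_bounded_field R"
    unfolding R_def
    using f by (intro ode_flow_field[OF lip, where C = C]) (auto simp: split_beta' intro: measurable_compose[OF measurable_snd])
  note \<psi>R = locally_bounded_field_lipschitz[OF R \<psi>(1)]
  define u where "u t x = Q t (R t) x" for t x
  have u: "locally_bounded_field u"
    unfolding locally_bounded_field_def
  proof (intro conjI allI)
    have "(\<lambda>(p, y). R (fst p) y) \<in> borel_measurable ((borel \<Otimes>\<^sub>M (borel :: 'a measure)) \<Otimes>\<^sub>M borel)"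
      unfolding split_beta' by (rule locally_bounded_field_measurable_compose[OF R]) measurable
    then show "(\<lambda>(t, x). u t x) \<in> borel_measurable (borel \<Otimes>\<^sub>M borel)"
      unfolding u_def split_beta' by (intro measurable_Q) auto
    fix T
    obtain B where "\<forall>t\<in>{0..T}. \<forall>y. \<bar>R t y\<bar> \<le> B"
      using locally_bounded_fieldD(2)[OF R] by blast
    then have "\<forall>t\<in>{0..T}. \<forall>x. \<bar>u t x\<bar> \<le> B"
      unfolding u_def by (auto intro!: Q_abs_le locally_bounded_field_section[OF R])
    then show "\<exists>B. \<forall>t\<in>{0..T}. \<forall>x. \<bar>u t x\<bar> \<le> B"
      by blast
  qed
  note \<psi>u = locally_bounded_field_lipschitz[OF u \<psi>(1)]
  have "u t x \<le> v t x"
  proof (rule duhamel_comparison[OF u mild_solutionD(1)[OF sol] \<psi> L _ _ t, where f = f])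
    show "duhamel L ?\<psi> f v t x \<le> v t x" if "0 \<le> t" for t x
      using mild_solution_absorb_decay[OF lip f sol L that] by simp
    fix t :: real and x :: 'a assume t: "0 \<le> t"
    obtain A where A: "\<forall>r\<in>{0..t}. \<forall>y. \<bar>R r y\<bar> \<le> A"
      using locally_bounded_fieldD(2)[OF R] by blast
    obtain B where B: "0 \<le> B" "\<forall>r\<in>{0..t}. \<forall>y. \<bar>?\<psi> (R r y)\<bar> \<le> B"
      using locally_bounded_fieldD(2)[OF \<psi>R] by blast
    obtain D where D: "\<forall>r\<in>{0..t}. \<forall>y. \<bar>?\<psi> (u r y)\<bar> \<le> D"
      using locally_bounded_fieldD(2)[OF \<psi>u] by blast
    define h where "h s y = exp (- L * s) * ?\<psi> (R (t - s) y)" for s y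
    have hm: "(\<lambda>(s, y). h s y) \<in> borel_measurable (borel \<Otimes>\<^sub>M borel)"
    proof -
      have [measurable]: "(\<lambda>p. ?\<psi> (R (t - fst p) (snd p))) \<in> borel_measurable (borel \<Otimes>\<^sub>M borel)"
        by (rule locally_bounded_field_measurable_compose[OF \<psi>R]) measurable
      show ?thesis
        unfolding h_def split_beta' by measurable
    qed
    have e: "exp (- L * s) \<le> 1" if "s \<in> {0..t}" for s
      using that L by simp
    have hb: "\<bar>h s y\<bar> \<le> B" if s: "s \<in> {0..t}" for s y
    proof -
      have "exp (- L * s) * \<bar>?\<psi> (R (t - s) y)\<bar> \<le> 1 * B"
        using s B e[OF s] by (intro mult_mono) auto
      then show ?thesis
        by (simp add: h_def abs_mult)
    qed
    have hs: "(\<lambda>s. h s y) \<in> borel_measurable borel" for y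
    proof -
      have "(\<lambda>s. (s, y)) \<in> borel \<rightarrow>\<^sub>M borel \<Otimes>\<^sub>M borel"
        by simp
      from measurable_compose[OF this hm] show ?thesis
        by simp
    qed
    have hs': "h s \<in> borel_measurable borel" for s
    proof -
      have "(\<lambda>y. (s, y)) \<in> borel \<rightarrow>\<^sub>M borel \<Otimes>\<^sub>M borel"
        by simp
      from measurable_compose[OF this hm] show ?thesis
        by simp
    qed
    have Rt: "R t = (\<lambda>y. exp (- L * t) * f y + (LINT s:{0..t}|lborel. h s y))"
    proof
      fix y
      have "ode_flow \<phi> t (f y) = exp (- L * t) * f y
          + (LINT s:{0..t}|lborel. exp (- L * s) * ?\<psi> (ode_flow \<phi> (t - s) (f y)))"
        by (rule ode_flow_duhamel(1)[OF lip t])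
      also have "(LINT s:{0..t}|lborel. exp (- L * s) * ?\<psi> (ode_flow \<phi> (t - s) (f y)))
          = (LINT s:{0..t}|lborel. h s y)"
        by (intro set_lebesgue_integral_cong) (auto simp: h_def R_def)
      finally show "R t y = exp (- L * t) * f y + (LINT s:{0..t}|lborel. h s y)"
        using t by (simp add: R_def)
    qed
    have "u t x = Q t (\<lambda>y. exp (- L * t) * f y) x + Q t (\<lambda>y. LINT s:{0..t}|lborel. h s y) x"
      unfolding u_def Rt
    proof (rule Q_add[where B = "exp (- L * t) * C" and C = "(t - 0) * B"])
      show "(\<lambda>y. exp (- L * t) * f y) \<in> borel_measurable borel"
        using f by measurable
      show "\<bar>exp (- L * t) * f y\<bar> \<le> exp (- L * t) * C" for y
        using f(2)[of y] by (simp add: abs_mult)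
      have "(\<lambda>(y, s). h s y) \<in> borel_measurable (borel \<Otimes>\<^sub>M borel)"
        using measurable_pair_swap[OF hm] by (simp add: split_beta')
      then show "(\<lambda>y. LINT s:{0..t}|lborel. h s y) \<in> borel_measurable borel"
        by (intro measurable_LINT_Icc) auto
      show "\<bar>LINT s:{0..t}|lborel. h s y\<bar> \<le> (t - 0) * B" for y
        by (intro LINT_Icc_abs_le t hs hb)
    qed
    also have "Q t (\<lambda>y. LINT s:{0..t}|lborel. h s y) x = (LINT s:{0..t}|lborel. Q t (h s) x)"
      by (rule Q_LINT[OF hm hb])
    finally have u_eq: "u t x = Q t (\<lambda>y. exp (- L * t) * f y) x + (LINT s:{0..t}|lborel. Q t (h s) x)" .
    have "(LINT s:{0..t}|lborel. Q t (h s) x)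
        \<le> (LINT s:{0..t}|lborel. exp (- L * s) * Q s (\<lambda>y. ?\<psi> (u (t - s) y)) x)"
    proof (rule set_integral_mono[OF _ duhamel_set_integrable[OF u \<psi>(1) L order_refl order_refl]])
      have "(\<lambda>s. Q t (h s) x) \<in> borel_measurable borel"
        using hm by (intro measurable_Q) auto
      then show "set_integrable lborel {0..t} (\<lambda>s. Q t (h s) x)"
        by (rule set_integrable_bounded_Icc) (rule Q_abs_le[OF hs' hb])
      fix s assume s: "s \<in> {0..t}"
      let ?g = "\<lambda>y. ?\<psi> (R (t - s) y)"
      have g: "?g \<in> borel_measurable borel" "\<bar>?g y\<bar> \<le> B" for y
        using B s locally_bounded_field_section[OF \<psi>R] by auto
      have "Q t ?g x = Q s (Q (t - s) ?g) x"
        using s by (subst Q_semigroup[OF g]) auto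
      also have "\<dots> \<le> Q s (\<lambda>y. ?\<psi> (u (t - s) y)) x"
      proof (rule Q_mono[OF measurable_Q_fixed[OF g(1)] Q_abs_le[OF g] locally_bounded_field_section[OF \<psi>u]])
        show "\<bar>?\<psi> (u (t - s) y)\<bar> \<le> D" for y
          using D s by auto
        show "Q (t - s) ?g y \<le> ?\<psi> (u (t - s) y)" for y
          unfolding u_def
        proof (rule Q_jensen[OF concave_add_linear[OF conc] locally_bounded_field_section[OF R] _ g])
          show "\<bar>R (t - s) y\<bar> \<le> A" for y
            using A s by auto
        qed
      qed
      finally show "Q t (h s) x \<le> exp (- L * s) * Q s (\<lambda>y. ?\<psi> (u (t - s) y)) x"
        unfolding h_def Q_cmult by (rule mult_left_mono) simp
    qed
    then show "u t x \<le> duhamel L ?\<psi> f u t x"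
      unfolding u_eq duhamel_def Q_cmult by (rule add_left_mono)
  qed
  with t show ?thesis
    by (simp add: u_def R_def[abs_def])
qed

lemma borel_bounded_Q:
  assumes "g \<in> borel_measurable borel" "bounded (range g)"
  shows "Q t g \<in> borel_measurable borel" "bounded (range (Q t g))"
proof -
  show "Q t g \<in> borel_measurable borel"
    by (rule measurable_Q_fixed[OF assms(1)])
  obtain B where "\<And>y. \<bar>g y\<bar> \<le> B"
    using assms(2) by (auto simp: bounded_iff)
  from Q_abs_le[OF assms(1) this] show "bounded (range (Q t g))"
    by (auto simp: bounded_iff)
qed

lemma Q_mono_bounded:
  assumes "g \<in> borel_measurable borel" "bounded (range g)"
    and "h \<in> borel_measurable borel" "bounded (range h)" and "\<And>y. g y \<le> h y"
  shows "Q t g x \<le> Q t h x"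
proof -
  obtain B C where "\<And>y. \<bar>g y\<bar> \<le> B" "\<And>y. \<bar>h y\<bar> \<le> C"
    using assms(2,4) by (auto simp: bounded_iff)
  with assms(1,3,5) show ?thesis
    by (intro Q_mono) auto
qed

end

lemma borel_bounded_reaction_op:
  fixes g :: "'a::topological_space \<Rightarrow> real"
  assumes lip: "L-lipschitz_on UNIV \<phi>" and t: "0 \<le> t"
    and g: "g \<in> borel_measurable borel" "bounded (range g)"
  shows "reaction_op \<phi> t g \<in> borel_measurable borel" "bounded (range (reaction_op \<phi> t g))"
proof -
  obtain C where C: "\<And>y. \<bar>g y\<bar> \<le> C"
    using g(2) by (auto simp: bounded_iff)
  have R: "locally_bounded_field (\<lambda>t y. ode_flow \<phi> (max 0 t) (g y))"
    using g(1) C by (intro ode_flow_field[OF lip]) (auto simp: split_beta' intro: measurable_compose[OF measurable_snd])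
  have eq: "reaction_op \<phi> t g = (\<lambda>y. ode_flow \<phi> (max 0 t) (g y))"
    using t by (auto simp: reaction_op_def)
  show "reaction_op \<phi> t g \<in> borel_measurable borel"
    unfolding eq by (rule locally_bounded_field_section[OF R])
  show "bounded (range (reaction_op \<phi> t g))"
  proof -
    obtain B where B: "\<forall>s\<in>{0..t}. \<forall>y. \<bar>ode_flow \<phi> (max 0 s) (g y)\<bar> \<le> B"
      using locally_bounded_fieldD(2)[OF R] by blast
    show ?thesis
      unfolding eq by (rule boundedI[of _ B]) (use B t in auto)
  qed
qed

context markov_kernels
begin

lemma mild_solution_section:
  assumes "mild_solution \<phi> f v" "0 \<le> t"
  shows "v t \<in> borel_measurable borel" "bounded (range (v t))"
proof -
  note v = mild_solutionD(1)[OF assms(1)]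
  show "v t \<in> borel_measurable borel"
    by (rule locally_bounded_field_section[OF v])
  show "bounded (range (v t))"
  proof -
    obtain B where B: "\<forall>s\<in>{0..t}. \<forall>y. \<bar>v s y\<bar> \<le> B"
      using locally_bounded_fieldD(2)[OF v] by blast
    show ?thesis
      by (rule boundedI[of _ B]) (use B assms(2) in auto)
  qed
qed

text \<open>
  One step of each inequality restarts the evolution from the state reached so far; the remaining
  steps go through because \<open>Q\<^sub>h\<close> and \<open>R\<^sub>h\<close> preserve order.
\<close>

lemma splitting_bounds:
  assumes lip: "L-lipschitz_on UNIV \<phi>" and conc: "concave_on UNIV \<phi>"
    and f: "f \<in> borel_measurable borel" "bounded (range f)"
    and sol: "mild_solution \<phi> f v" and h: "0 \<le> h"
  shows "((Q h \<circ> reaction_op \<phi> h) ^^ Suc n) f x \<le> v (real (Suc n) * h) x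
    \<and> v (real (Suc n) * h) x \<le> ((reaction_op \<phi> h \<circ> Q h) ^^ Suc n) f x"
proof -
  note R = borel_bounded_reaction_op[OF lip h]
  have lower: "(Q h \<circ> reaction_op \<phi> h) g x \<le> w h x" and upper: "w h x \<le> (reaction_op \<phi> h \<circ> Q h) g x"
    if g: "g \<in> borel_measurable borel" "bounded (range g)" and w: "mild_solution \<phi> g w" for g w x
  proof -
    obtain C where C: "\<And>y. \<bar>g y\<bar> \<le> C"
      using g(2) by (auto simp: bounded_iff)
    show "(Q h \<circ> reaction_op \<phi> h) g x \<le> w h x"
      using diffusion_after_reaction_le_mild_solution[OF lip conc g(1) C w h]
      by (simp add: reaction_op_def[abs_def])
    show "w h x \<le> (reaction_op \<phi> h \<circ> Q h) g x"
      using mild_solution_le_reaction_after_diffusion[OF lip conc g(1) C w h]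
      by (simp add: reaction_op_def)
  qed
  define a b where "a n = ((Q h \<circ> reaction_op \<phi> h) ^^ n) f"
    and "b n = ((reaction_op \<phi> h \<circ> Q h) ^^ n) f" for n
  have aS: "a (Suc n) = Q h (reaction_op \<phi> h (a n))" and bS: "b (Suc n) = reaction_op \<phi> h (Q h (b n))" for n
    by (simp_all add: a_def b_def)
  have a: "a n \<in> borel_measurable borel \<and> bounded (range (a n))" for n
    by (induction n) (auto simp: a_def[of 0] aS f intro: borel_bounded_Q R)
  have b: "b n \<in> borel_measurable borel \<and> bounded (range (b n))" for n
    by (induction n) (auto simp: b_def[of 0] bS f intro: borel_bounded_Q R)
  obtain C where C: "\<And>y. \<bar>f y\<bar> \<le> C"
    using f(2) by (auto simp: bounded_iff)
  have "a (Suc n) x \<le> v (real (Suc n) * h) x \<and> v (real (Suc n) * h) x \<le> b (Suc n) x" for n x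
  proof (induction n arbitrary: x)
    case 0
    show ?case
      using lower[OF f sol, of x] upper[OF f sol, of x] by (simp add: a_def b_def)
  next
    case (Suc n)
    define s where "s = real (Suc n) * h"
    have s: "0 \<le> s"
      using h by (simp add: s_def)
    have sS: "real (Suc (Suc n)) * h = s + h"
      by (simp add: s_def algebra_simps)
    note restart = mild_solution_restart[OF lip f(1) C sol s]
    note vs = mild_solution_section[OF sol s]
    have IH: "a (Suc n) y \<le> v s y" "v s y \<le> b (Suc n) y" for y
      using Suc[of y] by (simp_all add: s_def)
    have "a (Suc (Suc n)) x \<le> Q h (reaction_op \<phi> h (v s)) x"
      unfolding aS[of "Suc n"]
      using a[of "Suc n"] vs monoD[OF mono_ode_flow[OF lip h] IH(1)]
      by (intro Q_mono_bounded R) (auto simp: reaction_op_def)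
    also have "\<dots> \<le> v (s + h) x"
      using lower[OF vs restart] by simp
    finally have 1: "a (Suc (Suc n)) x \<le> v (s + h) x" .
    have "v (s + h) x \<le> reaction_op \<phi> h (Q h (v s)) x"
      using upper[OF vs restart] by simp
    also have "\<dots> \<le> b (Suc (Suc n)) x"
      unfolding bS[of "Suc n"] reaction_op_def[of _ _ "Q h _"]
      using b[of "Suc n"] vs IH(2) by (intro monoD[OF mono_ode_flow[OF lip h]] Q_mono_bounded) auto
    finally show ?case
      using 1 by (simp only: sS)
  qed
  then show ?thesis
    by (simp only: a_def b_def)
qed

end

section \<open>Transition kernels of a right-continuous strong Markov process\<close>

context strong_markov_process
begin

lemma X_measurable: "0 \<le> t \<Longrightarrow> X t \<in> M \<rightarrow>\<^sub>M borel"
  by (rule measurable_from_subalg[OF F_subalgebra adapted])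

lemma space_P: "space (P x) = space M"
  by (rule sets_eq_imp_space_eq[OF sets_P])

lemma X_measurable_P: "0 \<le> t \<Longrightarrow> X t \<in> P x \<rightarrow>\<^sub>M borel"
  using X_measurable by (simp add: measurable_cong_sets[OF sets_P refl])

text \<open>
  Negative times are sent to \<open>0\<close>, so that the kernels form a measurable family indexed by all
  real times.
\<close>

definition kernel :: "real \<Rightarrow> 'a \<Rightarrow> 'a measure" where
  "kernel t x = distr (P x) borel (X (max 0 t))"

lemma sets_kernel_eq [simp]: "sets (kernel t x) = sets borel" "space (kernel t x) = UNIV"
  by (simp_all add: kernel_def)

lemma prob_space_kernel: "prob_space (kernel t x)"
  unfolding kernel_def by (intro prob_space.prob_space_distr prob_space_P X_measurable_P) simp

lemma measure_kernel:
  assumes "B \<in> sets borel"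
  shows "measure (kernel t x) B = measure (P x) {\<omega> \<in> space M. X (max 0 t) \<omega> \<in> B}"
  unfolding kernel_def using assms
  by (subst measure_distr) (auto intro!: X_measurable_P arg_cong[where f = "measure (P x)"] simp: space_P)

lemma emeasure_kernel: "emeasure (kernel t x) B = ennreal (measure (kernel t x) B)"
proof -
  interpret prob_space "kernel t x"
    by (rule prob_space_kernel)
  show ?thesis
    by (rule emeasure_eq_measure)
qed

lemma integral_kernel:
  fixes g :: "'a \<Rightarrow> real"
  assumes "g \<in> borel_measurable borel"
  shows "integral\<^sup>L (kernel t x) g = (\<integral>\<omega>. g (X (max 0 t) \<omega>) \<partial>P x)"
  unfolding kernel_def using assms by (intro integral_distr X_measurable_P) auto

lemma kernel_measurable: "kernel t \<in> borel \<rightarrow>\<^sub>M subprob_algebra borel"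
proof (rule measurable_subprob_algebra)
  show "subprob_space (kernel t x)" for x
    by (rule prob_space_imp_subprob_space[OF prob_space_kernel])
  show "(\<lambda>x. emeasure (kernel t x) A) \<in> borel_measurable borel" if "A \<in> sets borel" for A
    unfolding emeasure_kernel measure_kernel[OF that]
    using transition_measurable[of "max 0 t" A] that by simp
qed simp

lemma integral_kernel_measurable:
  fixes g :: "'a \<Rightarrow> real"
  assumes "g \<in> borel_measurable borel"
  shows "(\<lambda>x. integral\<^sup>L (kernel t x) g) \<in> borel_measurable borel"
  by (rule measurable_compose[OF kernel_measurable integral_measurable_subprob_algebra[OF assms]])

text \<open>The strong Markov property at the constant stopping time \<open>s\<close>, integrated.\<close>

lemma markov_property:
  fixes g :: "'a \<Rightarrow> real"
  assumes g: "g \<in> borel_measurable borel" "bounded (range g)" and "0 \<le> s" "0 \<le> t"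
  shows "(\<integral>\<omega>. g (X (s + t) \<omega>) \<partial>P x) = (\<integral>\<omega>. integral\<^sup>L (kernel t (X s \<omega>)) g \<partial>P x)"
proof -
  interpret prob_space "P x"
    by (rule prob_space_P)
  define \<tau> :: "'w \<Rightarrow> ennreal" where "\<tau> = (\<lambda>_. ennreal s)"
  have \<tau>: "stopping_time F \<tau>"
    unfolding \<tau>_def by (rule stopping_time_const)
  have "subalgebra (P x) (pre_sigma \<tau>)"
    unfolding subalgebra_def
  proof (intro conjI subsetI)
    show "space (pre_sigma \<tau>) = space (P x)"
      by (simp add: space_pre_sigma space_P)
    fix A assume "A \<in> sets (pre_sigma \<tau>)"
    from sets_pre_sigmaD[OF \<tau> this, of top] have "A \<in> sets (F top)"
      by simp
    then show "A \<in> sets (P x)"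
      using F_subalgebra[of top] sets_P by (auto simp: subalgebra_def)
  qed
  then interpret finite_measure_subalgebra "P x" "pre_sigma \<tau>"
    by unfold_locales
  obtain B where B: "\<And>y. \<bar>g y\<bar> \<le> B"
    using g(2) by (auto simp: bounded_iff)
  have gX: "(\<lambda>\<omega>. g (X (s + t) \<omega>)) \<in> borel_measurable (P x)"
    using assms by (intro measurable_compose[OF X_measurable_P g(1)]) simp
  have "integrable (P x) (\<lambda>\<omega>. g (X (s + t) \<omega>))"
    by (rule integrable_const_bound[of _ B, OF _ gX]) (simp add: B)
  from real_cond_exp_int(2)[OF this]
  have "(\<integral>\<omega>. g (X (s + t) \<omega>) \<partial>P x)
      = (\<integral>\<omega>. real_cond_exp (P x) (pre_sigma \<tau>) (\<lambda>\<omega>. g (X (s + t) \<omega>)) \<omega> \<partial>P x)"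
    by simp
  also have "\<dots> = (\<integral>\<omega>. integral\<^sup>L (kernel t (X s \<omega>)) g \<partial>P x)"
  proof (rule integral_cong_AE)
    show "(\<lambda>\<omega>. integral\<^sup>L (kernel t (X s \<omega>)) g) \<in> borel_measurable (P x)"
      using assms by (intro measurable_compose[OF X_measurable_P integral_kernel_measurable])
    show "AE \<omega> in P x. real_cond_exp (P x) (pre_sigma \<tau>) (\<lambda>\<omega>. g (X (s + t) \<omega>)) \<omega>
        = integral\<^sup>L (kernel t (X s \<omega>)) g"
      using strong_markov[OF \<tau> \<open>0 \<le> t\<close> g, of x] assms
      by (simp add: \<tau>_def integral_kernel)
  qed simp
  finally show ?thesis .
qed

lemma kernel_chapman_kolmogorov:
  assumes "0 \<le> s" "0 \<le> t"
  shows "kernel (s + t) x = kernel s x \<bind> kernel t"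
proof (rule measure_eqI)
  have k: "kernel t \<in> kernel s x \<rightarrow>\<^sub>M subprob_algebra borel"
    using kernel_measurable by (simp cong: measurable_cong_sets)
  show "sets (kernel (s + t) x) = sets (kernel s x \<bind> kernel t)"
    by (subst sets_bind[where N = borel]) auto
  fix A assume "A \<in> sets (kernel (s + t) x)"
  then have A: "A \<in> sets borel"
    by simp
  interpret prob_space "kernel s x"
    by (rule prob_space_kernel)
  have m: "(\<lambda>y. measure (kernel t y) A) \<in> borel_measurable borel"
    using integral_kernel_measurable[of "indicator A" t] A by simp
  have mk: "measure (kernel r y) A = (\<integral>\<omega>. indicator A (X (max 0 r) \<omega>) \<partial>P y)" for r y
    using integral_kernel[of "indicator A" r y] A by simp
  have "emeasure (kernel s x \<bind> kernel t) A = (\<integral>\<^sup>+y. emeasure (kernel t y) A \<partial>kernel s x)"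
    by (rule emeasure_bind[OF _ k A]) simp
  also have "\<dots> = (\<integral>\<^sup>+y. ennreal (measure (kernel t y) A) \<partial>kernel s x)"
    by (simp only: emeasure_kernel)
  also have "\<dots> = ennreal (\<integral>y. measure (kernel t y) A \<partial>kernel s x)"
  proof (rule nn_integral_eq_integral)
    show "integrable (kernel s x) (\<lambda>y. measure (kernel t y) A)"
      using m prob_space.prob_le_1[OF prob_space_kernel]
      by (intro integrable_const_bound[of _ 1]) (auto cong: measurable_cong_sets)
  qed simp
  also have "(\<integral>y. measure (kernel t y) A \<partial>kernel s x) = (\<integral>\<omega>. measure (kernel t (X s \<omega>)) A \<partial>P x)"
    using integral_kernel[OF m] assms by simp
  also have "\<dots> = (\<integral>\<omega>. integral\<^sup>L (kernel t (X s \<omega>)) (indicator A) \<partial>P x)"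
    by simp
  also have "\<dots> = (\<integral>\<omega>. indicator A (X (s + t) \<omega>) \<partial>P x)"
    using A assms by (intro markov_property[symmetric]) (auto simp: bounded_iff intro!: exI[of _ 1] split: split_indicator)
  also have "\<dots> = measure (kernel (s + t) x) A"
    using mk[of "s + t" x] assms by simp
  finally show "emeasure (kernel (s + t) x) A = emeasure (kernel s x \<bind> kernel t) A"
    by (simp add: emeasure_kernel)
qed

end

text \<open>
  The grid points approach \<open>t\<close> strictly from the right, which is the side on which paths are
  continuous.
\<close>

definition right_grid :: "nat \<Rightarrow> real \<Rightarrow> real" where
  "right_grid n t = (of_int \<lfloor>real (Suc n) * t\<rfloor> + 1) / real (Suc n)"

lemma less_right_grid: "t < right_grid n t"
proof -
  have "real (Suc n) * t < of_int \<lfloor>real (Suc n) * t\<rfloor> + 1"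
    by linarith
  then show ?thesis
    unfolding right_grid_def by (subst pos_less_divide_eq) (simp_all only: mult.commute of_nat_0_less_iff zero_less_Suc)
qed

lemma right_grid_nonneg: "0 \<le> t \<Longrightarrow> 0 \<le> right_grid n t"
  using less_right_grid[of t n] by linarith

lemma right_grid_le: "right_grid n t \<le> t + 1 / real (Suc n)"
proof -
  have "of_int \<lfloor>real (Suc n) * t\<rfloor> + 1 \<le> real (Suc n) * t + 1"
    by linarith
  then have "right_grid n t \<le> (real (Suc n) * t + 1) / real (Suc n)"
    unfolding right_grid_def by (rule divide_right_mono) simp
  also have "\<dots> = t + 1 / real (Suc n)"
    by (simp add: add_divide_distrib)
  finally show ?thesis .
qed

lemma filterlim_right_grid: "filterlim (\<lambda>n. right_grid n t) (at_right t) sequentially"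
  unfolding filterlim_at
proof
  have "right_grid n t \<in> {t<..} \<and> right_grid n t \<noteq> t" for n
    using less_right_grid[of t n] by simp
  then show "\<forall>\<^sub>F n in sequentially. right_grid n t \<in> {t<..} \<and> right_grid n t \<noteq> t"
    by (intro always_eventually allI)
  have "(\<lambda>n. t + 1 / real (Suc n)) \<longlonglongrightarrow> t + 0"
    by (intro tendsto_add tendsto_const LIMSEQ_Suc[OF lim_1_over_n])
  then have lim: "(\<lambda>n. t + 1 / real (Suc n)) \<longlonglongrightarrow> t"
    by simp
  show "(\<lambda>n. right_grid n t) \<longlonglongrightarrow> t"
    by (rule tendsto_sandwich[OF _ _ tendsto_const lim])
      (intro always_eventually allI less_imp_le less_right_grid right_grid_le)+
qed

lemma jointly_measurable_along_grid:
  fixes H :: "real \<Rightarrow> 'p \<Rightarrow> 'q :: topological_space"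
  assumes H: "\<And>s. H s \<in> N \<rightarrow>\<^sub>M borel"
  shows "(\<lambda>(t, p). H (right_grid n (max 0 t)) p) \<in> borel \<Otimes>\<^sub>M N \<rightarrow>\<^sub>M borel"
proof -
  have "(\<lambda>q. H ((of_int \<lfloor>real (Suc n) * max 0 (fst q)\<rfloor> + 1) / real (Suc n)) (snd q)) \<in> borel \<Otimes>\<^sub>M N \<rightarrow>\<^sub>M borel"
  proof (rule measurable_compose_countable[where f = "\<lambda>i q. H ((of_int i + 1) / real (Suc n)) (snd q)"])
    show "(\<lambda>q. H ((of_int i + 1) / real (Suc n)) (snd q)) \<in> borel \<Otimes>\<^sub>M N \<rightarrow>\<^sub>M borel" for i :: int
      by (rule measurable_compose[OF measurable_snd H])
    show "(\<lambda>q. \<lfloor>real (Suc n) * max 0 (fst q)\<rfloor>) \<in> (borel :: real measure) \<Otimes>\<^sub>M N \<rightarrow>\<^sub>M count_space UNIV"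
      by measurable
  qed
  then show ?thesis
    by (simp add: right_grid_def split_beta')
qed

lemma tendsto_indicator_closed:
  fixes A :: "'a::metric_space set"
  assumes "closed A" "A \<noteq> {}"
  shows "(\<lambda>k. max 0 (1 - real k * infdist y A)) \<longlonglongrightarrow> indicator A y"
proof (cases "y \<in> A")
  case True
  then show ?thesis
    by simp
next
  case False
  then have d: "0 < infdist y A"
    using assms in_closed_iff_infdist_zero[of A y] infdist_nonneg[of y A] by (auto simp: less_le)
  have zero: "max 0 (1 - real k * infdist y A) = 0" if "k \<ge> nat \<lceil>1 / infdist y A\<rceil>" for k
  proof -
    have "1 / infdist y A \<le> real k"
      using that by linarith
    then show ?thesis
      using d by (simp add: pos_divide_le_eq)
  qed
  have "\<forall>\<^sub>F k in sequentially. max 0 (1 - real k * infdist y A) = indicator A y"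
    unfolding eventually_sequentially
  proof (intro exI allI impI)
    fix k assume "nat \<lceil>1 / infdist y A\<rceil> \<le> k"
    then show "max 0 (1 - real k * infdist y A) = indicator A y"
      using zero[of k] False by simp
  qed
  then show ?thesis
    by (rule tendsto_eventually)
qed

context right_continuous_strong_markov_process
begin

lemma X_right_grid:
  assumes "\<omega> \<in> space M" "0 \<le> t"
  shows "(\<lambda>n. X (right_grid n t) \<omega>) \<longlonglongrightarrow> X t \<omega>"
proof -
  have "((\<lambda>s. X s \<omega>) \<longlongrightarrow> X t \<omega>) (at_right t)"
    using right_continuous[OF assms] by (simp add: continuous_within)
  from filterlim_compose[OF this filterlim_right_grid] show ?thesis .
qed

text \<open>
  Without joint measurability of the paths in time and chance, expectation and time integral could
  not be exchanged.
\<close>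

lemma X_jointly_measurable: "(\<lambda>(t, \<omega>). X (max 0 t) \<omega>) \<in> borel \<Otimes>\<^sub>M M \<rightarrow>\<^sub>M borel"
proof (rule borel_measurable_LIMSEQ_metric)
  show "(\<lambda>(t, \<omega>). X (max 0 (right_grid n (max 0 t))) \<omega>) \<in> borel \<Otimes>\<^sub>M M \<rightarrow>\<^sub>M borel" for n
    by (rule jointly_measurable_along_grid[where H = "\<lambda>s. X (max 0 s)"]) (rule X_measurable, simp)
  show "(\<lambda>n. case p of (t, \<omega>) \<Rightarrow> X (max 0 (right_grid n (max 0 t))) \<omega>)
      \<longlonglongrightarrow> (case p of (t, \<omega>) \<Rightarrow> X (max 0 t) \<omega>)" if "p \<in> space (borel \<Otimes>\<^sub>M M)" for p
    using that X_right_grid[of "snd p" "max 0 (fst p)"]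
    by (auto simp: space_pair_measure max_absorb2 right_grid_nonneg)
qed

text \<open>
  Right-continuity makes \<open>t \<mapsto> E\<^sub>x g(X\<^sub>t)\<close> the limit of step functions when \<open>g\<close> is continuous; the
  indicators of closed sets are limits of such \<open>g\<close>, and closed sets generate the Borel sets.
\<close>

lemma integral_kernel_jointly_measurable:
  fixes g :: "'b \<Rightarrow> real"
  assumes g: "continuous_on UNIV g" "\<And>y. \<bar>g y\<bar> \<le> B"
  shows "(\<lambda>(t, x). integral\<^sup>L (kernel t x) g) \<in> borel_measurable (borel \<Otimes>\<^sub>M borel)"
proof (rule borel_measurable_LIMSEQ_metric)
  have gm: "g \<in> borel_measurable borel"
    by (rule borel_measurable_continuous_onI[OF g(1)])
  show "(\<lambda>(t, x). integral\<^sup>L (kernel (right_grid n (max 0 t)) x) g)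
      \<in> borel_measurable (borel \<Otimes>\<^sub>M borel)" for n
    by (rule jointly_measurable_along_grid[where H = "\<lambda>s x. integral\<^sup>L (kernel s x) g"])
      (rule integral_kernel_measurable[OF gm])
  have lim: "(\<lambda>n. integral\<^sup>L (kernel (right_grid n (max 0 t)) x) g) \<longlonglongrightarrow> integral\<^sup>L (kernel t x) g" for t x
  proof -
    interpret prob_space "P x"
      by (rule prob_space_P)
    have "(\<lambda>n. \<integral>\<omega>. g (X (right_grid n (max 0 t)) \<omega>) \<partial>P x) \<longlonglongrightarrow> (\<integral>\<omega>. g (X (max 0 t) \<omega>) \<partial>P x)"
    proof (rule integral_dominated_convergence[where w = "\<lambda>_. B"])
      show "(\<lambda>\<omega>. g (X (max 0 t) \<omega>)) \<in> borel_measurable (P x)"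
        by (intro measurable_compose[OF X_measurable_P gm]) simp
      show "(\<lambda>\<omega>. g (X (right_grid n (max 0 t)) \<omega>)) \<in> borel_measurable (P x)" for n
        by (intro measurable_compose[OF X_measurable_P gm]) (simp add: right_grid_nonneg)
      show "AE \<omega> in P x. (\<lambda>n. g (X (right_grid n (max 0 t)) \<omega>)) \<longlonglongrightarrow> g (X (max 0 t) \<omega>)"
      proof (rule AE_I2)
        fix \<omega> assume "\<omega> \<in> space (P x)"
        then have "(\<lambda>n. X (right_grid n (max 0 t)) \<omega>) \<longlonglongrightarrow> X (max 0 t) \<omega>"
          by (intro X_right_grid) (simp_all add: space_P)
        then show "(\<lambda>n. g (X (right_grid n (max 0 t)) \<omega>)) \<longlonglongrightarrow> g (X (max 0 t) \<omega>)"
          by (intro continuous_on_tendsto_compose[OF g(1)]) auto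
      qed
      show "AE \<omega> in P x. norm (g (X (right_grid n (max 0 t)) \<omega>)) \<le> B" for n
        using g(2) by simp
    qed simp
    then show ?thesis
      by (simp add: integral_kernel[OF gm] max_absorb2 right_grid_nonneg)
  qed
  show "(\<lambda>n. case p of (t, x) \<Rightarrow> integral\<^sup>L (kernel (right_grid n (max 0 t)) x) g)
      \<longlonglongrightarrow> (case p of (t, x) \<Rightarrow> integral\<^sup>L (kernel t x) g)" for p
    using lim by (simp add: split_beta)
qed

lemma measure_kernel_closed_measurable:
  assumes A: "closed A"
  shows "(\<lambda>(t, x). measure (kernel t x) A) \<in> borel_measurable (borel \<Otimes>\<^sub>M borel)"
proof (cases "A = {}")
  case False
  let ?g = "\<lambda>k y. max 0 (1 - real k * infdist y A)"
  have g: "continuous_on UNIV (?g k)" "\<bar>?g k y\<bar> \<le> 1" for k y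
    using infdist_nonneg[of y A] by (auto intro!: continuous_intros)
  have lim: "(\<lambda>k. integral\<^sup>L (kernel t x) (?g k)) \<longlonglongrightarrow> measure (kernel t x) A" for t x
  proof -
    interpret prob_space "kernel t x"
      by (rule prob_space_kernel)
    have "(\<lambda>k. integral\<^sup>L (kernel t x) (?g k)) \<longlonglongrightarrow> integral\<^sup>L (kernel t x) (indicator A)"
    proof (rule integral_dominated_convergence[where w = "\<lambda>_. 1"])
      show "?g k \<in> borel_measurable (kernel t x)" for k
        using borel_measurable_continuous_onI[OF g(1)] by (simp cong: measurable_cong_sets)
      show "AE y in kernel t x. (\<lambda>k. ?g k y) \<longlonglongrightarrow> indicator A y"
        by (intro AE_I2 tendsto_indicator_closed[OF A False])
      show "AE y in kernel t x. norm (?g k y) \<le> 1" for k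
        using g(2) by (intro AE_I2) simp
    qed (use borel_closed[OF A] in \<open>auto intro!: borel_measurable_indicator\<close>)
    then show ?thesis
      by simp
  qed
  show ?thesis
  proof (rule borel_measurable_LIMSEQ_metric)
    show "(\<lambda>(t, x). integral\<^sup>L (kernel t x) (?g k)) \<in> borel_measurable (borel \<Otimes>\<^sub>M borel)" for k
      by (rule integral_kernel_jointly_measurable[OF g])
    show "(\<lambda>k. case p of (t, x) \<Rightarrow> integral\<^sup>L (kernel t x) (?g k))
        \<longlonglongrightarrow> (case p of (t, x) \<Rightarrow> measure (kernel t x) A)" for p
      using lim by (simp add: split_beta)
  qed
qed simp

lemma kernel_jointly_measurable:
  "(\<lambda>(t, x). kernel t x) \<in> borel \<Otimes>\<^sub>M borel \<rightarrow>\<^sub>M subprob_algebra borel"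
proof (rule measurable_subprob_algebra_generated[where \<Omega> = UNIV and G = "Collect closed"])
  show "sets (borel :: 'b measure) = sigma_sets UNIV (Collect closed)"
    unfolding borel_eq_closed by simp
  show "Int_stable (Collect closed :: 'b set set)"
    by (auto simp: Int_stable_def)
  show "(\<lambda>p. emeasure (case p of (t, x) \<Rightarrow> kernel t x) A) \<in> borel_measurable (borel \<Otimes>\<^sub>M borel)"
    if "A \<in> Collect closed" for A
    using measure_kernel_closed_measurable[of A] that by (simp add: split_beta' emeasure_kernel)
  show "(\<lambda>p. emeasure (case p of (t, x) \<Rightarrow> kernel t x) UNIV) \<in> borel_measurable (borel \<Otimes>\<^sub>M borel)"
    using measure_kernel_closed_measurable[of UNIV] by (simp add: split_beta' emeasure_kernel)
qed (auto intro: prob_space_imp_subprob_space[OF prob_space_kernel])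

sublocale markov_kernels kernel
  by (rule markov_kernels.intro[OF kernel_jointly_measurable prob_space_kernel kernel_chapman_kolmogorov])

lemma transition_op_eq_Q:
  assumes "g \<in> borel_measurable borel" "0 \<le> t"
  shows "transition_op P X t g = Q t g"
  using assms by (intro ext) (simp add: transition_op_def Q_def integral_kernel)


section \<open>The evolution operator\<close>

lemma expectation_eq_duhamel:
  assumes f: "f \<in> borel_measurable borel" "\<And>y. \<bar>f y\<bar> \<le> C"
    and v: "locally_bounded_field v" and \<phi>: "L-lipschitz_on UNIV \<phi>" and t: "0 \<le> t"
  shows "(\<integral>\<omega>. f (X t \<omega>) + (LINT s:{0..t}|lborel. \<phi> (v (t - s) (X s \<omega>))) \<partial>P x) = duhamel 0 \<phi> f v t x"
proof -
  interpret P: prob_space "P x"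
    by (rule prob_space_P)
  note w = locally_bounded_field_lipschitz[OF v \<phi>]
  define h where "h s \<omega> = \<phi> (v (t - s) (X (max 0 s) \<omega>))" for s \<omega>
  obtain B where B: "\<forall>s\<in>{0..t}. \<forall>y. \<bar>\<phi> (v s y)\<bar> \<le> B"
    using locally_bounded_fieldD(2)[OF w] by blast
  have hb: "\<bar>h s \<omega>\<bar> \<le> B" if "s \<in> {0..t}" for s \<omega>
    using B that by (auto simp: h_def)
  have hm: "(\<lambda>(s, \<omega>). h s \<omega>) \<in> borel_measurable (borel \<Otimes>\<^sub>M P x)"
  proof -
    have sets: "sets (borel \<Otimes>\<^sub>M P x) = sets (borel \<Otimes>\<^sub>M M)"
      by (intro sets_pair_measure_cong) (simp_all add: sets_P)
    have "(\<lambda>q. h (fst q) (snd q)) \<in> borel_measurable (borel \<Otimes>\<^sub>M M)"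
      unfolding h_def
      using X_jointly_measurable
      by (intro locally_bounded_field_measurable_compose[OF w]) (auto simp: split_beta')
    then show ?thesis
      by (simp add: split_beta' measurable_cong_sets[OF sets refl])
  qed
  note fub = P.integral_LINT_Icc[where h = h and a = 0 and b = t, OF hm hb]
  have int_f: "integrable (P x) (\<lambda>\<omega>. f (X t \<omega>))"
    using f t by (intro P.integrable_const_bound[of _ C] measurable_compose[OF X_measurable_P]) auto
  have LINT_h: "(LINT s:{0..t}|lborel. \<phi> (v (t - s) (X s \<omega>))) = (LINT s:{0..t}|lborel. h s \<omega>)" for \<omega>
    by (intro set_lebesgue_integral_cong) (auto simp: h_def)
  have h_Q: "(\<integral>\<omega>. h s \<omega> \<partial>P x) = Q s (\<lambda>y. \<phi> (v (t - s) y)) x" for s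
    using locally_bounded_field_section[OF w] by (simp add: Q_def integral_kernel h_def)
  have "(\<integral>\<omega>. f (X t \<omega>) + (LINT s:{0..t}|lborel. h s \<omega>) \<partial>P x)
      = (\<integral>\<omega>. f (X t \<omega>) \<partial>P x) + (LINT s:{0..t}|lborel. (\<integral>\<omega>. h s \<omega> \<partial>P x))"
    using Bochner_Integration.integral_add[OF int_f fub(2)] fub(1) by simp
  also have "(\<integral>\<omega>. f (X t \<omega>) \<partial>P x) = Q t f x"
    using f t by (simp add: Q_def integral_kernel)
  finally show ?thesis
    by (simp add: LINT_h h_Q duhamel_def)
qed

lemma evolution_solution_of_mild:
  assumes \<phi>: "L-lipschitz_on UNIV \<phi>" and f: "f \<in> borel_measurable borel" "\<And>y. \<bar>f y\<bar> \<le> C"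
    and sol: "mild_solution \<phi> f v"
  shows "evolution_solution P X \<phi> f v"
  unfolding evolution_solution_def
proof (intro conjI allI impI)
  note v = mild_solutionD(1)[OF sol]
  show "(\<lambda>(t, x). v t x) \<in> borel_measurable (restrict_space borel {0..} \<Otimes>\<^sub>M borel)"
    unfolding split_beta'
    by (intro locally_bounded_field_measurable_compose[OF v]
        measurable_compose[OF measurable_fst] measurable_restrict_space1) auto
  fix t :: real assume t: "0 \<le> t"
  obtain B where B: "\<forall>s\<in>{0..t}. \<forall>x. \<bar>v s x\<bar> \<le> B"
    using locally_bounded_fieldD(2)[OF v] by blast
  show "bounded ((\<lambda>(s, x). v s x) ` ({0..t} \<times> UNIV))"
    by (rule boundedI[of _ B]) (use B in auto)
  fix x
  show "v t x = (\<integral>\<omega>. f (X t \<omega>) + (LINT s:{0..t}|lborel. \<phi> (v (t - s) (X s \<omega>))) \<partial>P x)"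
    unfolding expectation_eq_duhamel[OF f v \<phi> t] using sol t unfolding mild_solution_def by blast
qed

lemma mild_solution_of_evolution:
  assumes \<phi>: "L-lipschitz_on UNIV \<phi>" and f: "f \<in> borel_measurable borel" "\<And>y. \<bar>f y\<bar> \<le> C"
    and sol: "evolution_solution P X \<phi> f v"
  shows "mild_solution \<phi> f (\<lambda>t. v (max 0 t))"
  unfolding mild_solution_def
proof (intro conjI allI impI)
  show v: "locally_bounded_field (\<lambda>t. v (max 0 t))"
    unfolding locally_bounded_field_def
  proof (intro conjI allI)
    have "(\<lambda>q. (max 0 (fst q), snd q)) \<in> (borel :: real measure) \<Otimes>\<^sub>M (borel :: 'b measure) \<rightarrow>\<^sub>M restrict_space borel {0..} \<Otimes>\<^sub>M borel"
      by (intro measurable_Pair measurable_restrict_space2) auto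
    from measurable_compose[OF this, of "\<lambda>(t, x). v t x" borel] sol
    show "(\<lambda>(t, x). v (max 0 t) x) \<in> borel_measurable (borel \<Otimes>\<^sub>M borel)"
      by (simp add: evolution_solution_def split_beta')
    fix T :: real
    have "bounded ((\<lambda>(s, x). v s x) ` ({0..max 0 T} \<times> UNIV))"
      using sol by (simp add: evolution_solution_def)
    then obtain B where B: "\<And>q. q \<in> {0..max 0 T} \<times> UNIV \<Longrightarrow> norm (case q of (s, x) \<Rightarrow> v s x) \<le> B"
      unfolding bounded_iff by blast
    have "\<bar>v (max 0 t) x\<bar> \<le> B" if "t \<in> {0..T}" for t x
      using B[of "(max 0 t, x)"] that by auto
    then show "\<exists>B. \<forall>t\<in>{0..T}. \<forall>x. \<bar>v (max 0 t) x\<bar> \<le> B"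
      by blast
  qed
  fix t :: real and x :: 'b assume t: "0 \<le> t"
  have "v t x = (\<integral>\<omega>. f (X t \<omega>) + (LINT s:{0..t}|lborel. \<phi> (v (t - s) (X s \<omega>))) \<partial>P x)"
    using sol t unfolding evolution_solution_def by blast
  also have "\<dots> = (\<integral>\<omega>. f (X t \<omega>) + (LINT s:{0..t}|lborel. \<phi> (v (max 0 (t - s)) (X s \<omega>))) \<partial>P x)"
  proof -
    have "(LINT s:{0..t}|lborel. \<phi> (v (t - s) (X s \<omega>)))
        = (LINT s:{0..t}|lborel. \<phi> (v (max 0 (t - s)) (X s \<omega>)))" for \<omega>
      by (intro set_lebesgue_integral_cong) auto
    then show ?thesis
      by (simp only:)
  qed
  also have "\<dots> = duhamel 0 \<phi> f (\<lambda>t. v (max 0 t)) t x"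
    by (rule expectation_eq_duhamel[OF f v \<phi> t])
  finally show "v (max 0 t) x = duhamel 0 \<phi> f (\<lambda>t. v (max 0 t)) t x"
    unfolding max_absorb2[OF t] .
qed

text \<open>
  Only values at times \<open>\<ge> 0\<close> are determined by the integral equation, so two solutions need not be
  equal as functions; their sections at time \<open>t\<close> are.
\<close>

lemma evolution_op_eq:
  assumes \<phi>: "L-lipschitz_on UNIV \<phi>" and f: "f \<in> borel_measurable borel" "\<And>y. \<bar>f y\<bar> \<le> C"
    and sol: "mild_solution \<phi> f v" and t: "0 \<le> t"
  shows "evolution_op P X \<phi> t f = v t"
  unfolding evolution_op_def
proof (rule the_equality)
  show "\<exists>v'. evolution_solution P X \<phi> f v' \<and> v t = v' t"
    using evolution_solution_of_mild[OF \<phi> f sol] by blast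
  fix g assume "\<exists>v'. evolution_solution P X \<phi> f v' \<and> g = v' t"
  then obtain v' where v': "evolution_solution P X \<phi> f v'" "g = v' t"
    by blast
  have "v' (max 0 t) x = v t x" for x
    by (rule mild_solution_unique[OF \<phi> f mild_solution_of_evolution[OF \<phi> f v'(1)] sol t])
  then show "g = v t"
    using t v'(2) by (simp add: fun_eq_iff)
qed

end

text \<open>
  The transition operator of the process and the operator of its kernels need agree only on measurable
  functions, so the iterated splittings have to be identified within the bounded measurable functions.
\<close>

lemma funpow_eq_on_invariant:
  assumes "\<And>g. I g \<Longrightarrow> A g = B g" "\<And>g. I g \<Longrightarrow> I (B g)" "I f"
  shows "(A ^^ n) f = (B ^^ n) f"
proof -
  have "(A ^^ n) f = (B ^^ n) f \<and> I ((B ^^ n) f)"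
    by (induction n) (simp_all add: assms)
  then show ?thesis ..
qed

theorem corollary3p1:
  fixes M :: "'w measure" and F :: "ennreal \<Rightarrow> 'w measure"
    and P :: "'a::polish_space \<Rightarrow> 'w measure" and X :: "real \<Rightarrow> 'w \<Rightarrow> 'a"
    and \<phi> :: "real \<Rightarrow> real" and f :: "'a \<Rightarrow> real" and n :: nat and t :: real and x :: 'a
  assumes "right_continuous_strong_markov_process M F P X"
    and "concave_on UNIV \<phi>"
    and "\<phi> differentiable_on UNIV"
    and "\<exists>L. L-lipschitz_on UNIV \<phi>"
    and "f \<in> borel_measurable borel" and "bounded (range f)"
    and "n \<ge> 1" and "t \<ge> 0"
  shows "((transition_op P X (t / real n) \<circ> reaction_op \<phi> (t / real n)) ^^ n) f x
      \<le> evolution_op P X \<phi> t f x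
    \<and> evolution_op P X \<phi> t f x
      \<le> ((reaction_op \<phi> (t / real n) \<circ> transition_op P X (t / real n)) ^^ n) f x"
proof -
  interpret right_continuous_strong_markov_process M F P X
    by fact
  obtain L where lip: "L-lipschitz_on UNIV \<phi>"
    using assms(4) by blast
  note conc = assms(2) and f = assms(5,6)
  obtain C where C: "\<And>y. \<bar>f y\<bar> \<le> C"
    using f(2) by (auto simp: bounded_iff)
  obtain v where sol: "mild_solution \<phi> f v"
    using mild_solution_exists[OF lip f(1) C] by blast
  obtain m where n: "n = Suc m"
    using \<open>n \<ge> 1\<close> by (cases n) auto
  define h where "h = t / real n"
  have h: "0 \<le> h" "real (Suc m) * h = t"
    using \<open>t \<ge> 0\<close> \<open>n \<ge> 1\<close> n by (auto simp: h_def)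
  let ?I = "\<lambda>g :: 'a \<Rightarrow> real. g \<in> borel_measurable borel \<and> bounded (range g)"
  note R = borel_bounded_reaction_op[OF lip h(1)]
  have "((transition_op P X h \<circ> reaction_op \<phi> h) ^^ Suc m) f = ((Q h \<circ> reaction_op \<phi> h) ^^ Suc m) f"
    by (rule funpow_eq_on_invariant[where I = ?I])
      (simp_all add: R f borel_bounded_Q transition_op_eq_Q h)
  moreover have "((reaction_op \<phi> h \<circ> transition_op P X h) ^^ Suc m) f = ((reaction_op \<phi> h \<circ> Q h) ^^ Suc m) f"
    by (rule funpow_eq_on_invariant[where I = ?I])
      (simp_all add: R f borel_bounded_Q transition_op_eq_Q h)
  moreover have "evolution_op P X \<phi> t f = v t"
    by (rule evolution_op_eq[OF lip f(1) C sol \<open>t \<ge> 0\<close>])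
  moreover note splitting_bounds[OF lip conc f sol h(1), of m x, unfolded h(2)]
  ultimately show ?thesis
    unfolding n[symmetric] h_def[symmetric] by (simp only:)
qed

end
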